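(* Let $\lambda\ge 0$, let $v\in C[0,T]$ with $v\ge 0$, let $w_0\ge 0$, and let $w$ satisfy $$D_t^{\bar\alpha} w(t)+\lambda w(t)=v(t)\quad\text{for }0<t\le T,\qquad w(0)=w_0.$$ Suppose that $w\in C[0,T]\cap W^{1,\infty}(\epsilon,t)$ for all $\epsilon,t$ with $0<\epsilon<t\le T$; if $\alpha_1=1$, suppose also that $w\in C^1(0,T]$. Set $\underline q_j=\min_{t\in[0,T]}q_j(t)$ for $j=1,\dots,\ell$. Then $$w(t)\ \ge\ w_0\max_{j=1,\dots,\ell}E_{\alpha_j,1}\bigl(-\lambda t^{\alpha_j}/\underline q_j\bigr)\qquad\text{for all }t\in[0,T],$$ where one sets $E_{\alpha_j,1}(-\lambda t^{\alpha_j}/\underline q_j)\equiv 0$ if $\underline q_j=0$.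
   Context: $T>0$; $\ell$ is a positive integer; $0<\alpha_\ell<\dots<\alpha_2<\alpha_1\le 1$ are constants; $q_1,\dots,q_\ell\in C[0,T]$ satisfy $q_i(t)\ge 0$ for each $i$ and $\sum_{i=1}^\ell q_i(t)>0$ for all $t\in[0,T]$. The multiterm operator is $D_t^{\bar\alpha}:=\sum_{i=1}^\ell q_i(t)D_t^{\alpha_i}$. For $\alpha_i<1$ the (reformulated Caputo) derivative is defined for $0<t\le T$ by $$\Gamma(1-\alpha_i)\,D_t^{\alpha_i}y(t)=t^{-\alpha_i}[y(t)-y(0)]+\int_0^t\alpha_i(t-s)^{-\alpha_i-1}[y(t)-y(s)]\,ds,$$ while $D_t^{1}y:=y'$. The two-parameter Mittag-Leffler function is $E_{\alpha,\beta}(s):=\sum_{k=0}^\infty s^k/\Gamma(\alpha k+\beta)$. *)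

theory Defs
  imports "HOL-Analysis.Analysis"
begin

text \<open>Where \<open>Gamma\<close> has a pole, its library value is 0, so the corresponding term is 0;
  this agrees with the usual convention for the entire function 1/Gamma.\<close>

definition mittag_leffler :: "real \<Rightarrow> real \<Rightarrow> real \<Rightarrow> real" where
  "mittag_leffler a b s = (\<Sum>k. s ^ k / Gamma (a * real k + b))"

text \<open>The derivative of a function on \<open>(0,T]\<close> is taken within \<open>(0,T]\<close>: it is the
  ordinary derivative for \<open>t < T\<close> and the left derivative at \<open>t = T\<close>. Values of the
  function outside \<open>[0,T]\<close> play no role.\<close>

definition caputo_deriv :: "real \<Rightarrow> real \<Rightarrow> (real \<Rightarrow> real) \<Rightarrow> real \<Rightarrow> real" where
  "caputo_deriv T a y t =
    (if a = 1 then vector_derivative y (at t within {0<..T})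
     else (t powr (- a) * (y t - y 0)
            + (LINT s:{0<..<t}|lebesgue. a * (t - s) powr (- a - 1) * (y t - y s)))
          / Gamma (1 - a))"

definition multiterm_deriv ::
  "real \<Rightarrow> nat \<Rightarrow> (nat \<Rightarrow> real) \<Rightarrow> (nat \<Rightarrow> real \<Rightarrow> real) \<Rightarrow> (real \<Rightarrow> real) \<Rightarrow> real \<Rightarrow> real" where
  "multiterm_deriv T l \<alpha> q y t = (\<Sum>i=1..l. q i t * caputo_deriv T (\<alpha> i) y t)"

definition C1_half_open :: "real \<Rightarrow> (real \<Rightarrow> real) \<Rightarrow> bool" where
  "C1_half_open T y \<longleftrightarrow>
    (\<exists>y'. continuous_on {0<..T} y' \<and>
          (\<forall>t\<in>{0<..T}. (y has_vector_derivative y' t) (at t within {0<..T})))"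

definition test_function :: "real \<Rightarrow> real \<Rightarrow> (real \<Rightarrow> real) \<Rightarrow> bool" where
  "test_function a b \<phi> \<longleftrightarrow>
    (\<forall>n. (deriv ^^ n) \<phi> differentiable_on UNIV) \<and>
    compact (closure {x. \<phi> x \<noteq> 0}) \<and> closure {x. \<phi> x \<noteq> 0} \<subseteq> {a<..<b}"

definition L_infinity :: "real \<Rightarrow> real \<Rightarrow> (real \<Rightarrow> real) \<Rightarrow> bool" where
  "L_infinity a b u \<longleftrightarrow>
    set_borel_measurable lebesgue {a<..<b} u \<and>
    (\<exists>C. AE x in lebesgue. x \<in> {a<..<b} \<longrightarrow> \<bar>u x\<bar> \<le> C)"

definition weak_derivative :: "real \<Rightarrow> real \<Rightarrow> (real \<Rightarrow> real) \<Rightarrow> (real \<Rightarrow> real) \<Rightarrow> bool" where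
  "weak_derivative a b u g \<longleftrightarrow>
    (\<forall>\<phi>. test_function a b \<phi> \<longrightarrow>
      (LINT x:{a<..<b}|lebesgue. u x * deriv \<phi> x) = - (LINT x:{a<..<b}|lebesgue. g x * \<phi> x))"

definition sobolev_W1_infinity :: "real \<Rightarrow> real \<Rightarrow> (real \<Rightarrow> real) \<Rightarrow> bool" where
  "sobolev_W1_infinity a b u \<longleftrightarrow>
    L_infinity a b u \<and> (\<exists>g. L_infinity a b g \<and> weak_derivative a b u g)"

text \<open>For \<open>f\<close> continuous on \<open>[0,T]\<close> the infimum is attained, so this is the minimum.\<close>

definition min_on :: "real \<Rightarrow> (real \<Rightarrow> real) \<Rightarrow> real" where
  "min_on T f = (INF t\<in>{0..T}. f t)"

definition ml_bound :: "real \<Rightarrow> real \<Rightarrow> real \<Rightarrow> real \<Rightarrow> real" where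
  "ml_bound lam a qmin t =
    (if qmin = 0 then 0 else mittag_leffler a 1 (- lam * t powr a / qmin))"

end

theory Submission
  imports Defs
begin

text \<open>The proof compares \<open>w\<close> with the explicit function \<open>e t = E\<^bsub>\<alpha>\<^sub>j,1\<^esub>(- c t powr \<alpha>\<^sub>j)\<close>, where
  \<open>c = \<lambda> / m\<close> and \<open>m > 0\<close> is the minimum of \<open>q\<^sub>j\<close>. This \<open>e\<close> solves the
  single-term equation \<open>D\<^bsup>\<alpha>\<^sub>j\<^esup> e = - c e\<close> with \<open>e 0 = 1\<close>, it is nonnegative and nonincreasing. A
  nonincreasing function has nonpositive Caputo derivatives of all orders, so discarding the terms
  \<open>i \<noteq> j\<close> leaves a multiterm derivative of at most \<open>- q\<^sub>j c e \<le> - \<lambda> e\<close>: \<open>e\<close> is a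
  subsolution of the homogeneous equation. The difference \<open>w - w\<^sub>0 e\<close> is then a supersolution that
  vanishes at \<open>0\<close>, and the minimum principle \<open>multiterm_nonneg\<close> says that it is nonnegative. If
  \<open>q\<^sub>j\<close> has minimum \<open>0\<close>, only \<open>w \<ge> 0\<close> is claimed, and this is the minimum principle applied
  to \<open>w\<close> itself.

  The minimum principle is a sign check. In the form used here, the Caputo derivative at a minimum
  point over \<open>[0,t]\<close> is a nonpositive boundary term plus an integral of nonpositive quantities (or, for order one, a left
  derivative).
  Adding \<open>\<epsilon> t\<close>, whose derivatives of all orders are positive, makes the inequality strict.

  For orders \<open>0 < a < 1\<close> the qualitative properties of \<open>e\<close> come from the same kind of sign check. Consider
  \<open>G\<^sub>b t = t powr (b - 1) E\<^bsub>a,b\<^esub>(- c t powr a)\<close>, for which \<open>e = G\<^sub>1\<close> and \<open>e' = - c G\<^sub>a\<close>.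
  Termwise integration of the power series (\<open>marchaud_relaxation\<close>) gives, for \<open>b \<ge> a\<close> and \<open>c \<ge> 0\<close>,
  \[ t^{-a} G_b(t) + \int_0^t a (t-s)^{-a-1} (G_b(t) - G_b(s))\,ds
     = \Gamma(1-a) \Bigl(\frac{t^{b-1-a}}{\Gamma(b-a)} - c\,G_b(t)\Bigr), \]
  where the fraction is \<open>0\<close> for \<open>b = a\<close>. At a first zero of \<open>G\<^sub>b\<close> the left-hand side would be negative
  and the right-hand side nonnegative; hence \<open>G\<^sub>b > 0\<close>. With \<open>b = 1\<close> this gives \<open>e \<ge> 0\<close> and the
  equation for \<open>e\<close>, with \<open>b = a\<close> it gives monotonicity. For \<open>a = 1\<close> the function \<open>e\<close> is an
  exponential.

  For this calculus the integrals must converge. For \<open>w\<close> this rests on the Sobolev hypothesis: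
  testing the weak derivative with smooth plateaus, which are differences of two steep smooth steps,
  shows that a continuous function with bounded weak derivative is Lipschitz
  (\<open>weak_derivative_bounded_imp_lipschitz\<close>).\<close>

section \<open>Mittag-Leffler series and the Marchaud integral of a power\<close>

text \<open>Euler's integral restricted to \<open>[M,\<infinity>)\<close>, where the power is at least \<open>M powr (x - 1)\<close>. As \<open>M\<close> is
  arbitrary, \<open>Gamma\<close> outgrows every geometric sequence, which is what convergence of the
  Mittag-Leffler series needs.\<close>
lemma Gamma_real_lower_bound:
  fixes M x :: real
  assumes "M > 0" "x \<ge> 1"
  shows "M powr (x - 1) * exp (- M) \<le> Gamma x"
proof (rule has_integral_le)
  show "((\<lambda>t. M powr (x - 1) * (if t \<in> {M..} then exp (- t) else 0))
          has_integral M powr (x - 1) * exp (- M)) {0..}"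
  proof (rule has_integral_mult_right)
    have "{M..} \<subseteq> {0..}" using assms by auto
    then show "((\<lambda>t. if t \<in> {M..} then exp (- t) else 0) has_integral exp (- M)) {0..}"
      using has_integral_exp_minus_to_infinity[of 1 M] by (subst has_integral_restrict) auto
  qed
  show "((\<lambda>t. t powr (x - 1) / exp t) has_integral Gamma x) {0..}"
    using assms by (intro Gamma_integral_real) auto
  fix t :: real assume "t \<in> {0..}"
  then show "M powr (x - 1) * (if t \<in> {M..} then exp (- t) else 0) \<le> t powr (x - 1) / exp t"
    using assms by (auto simp: exp_minus divide_inverse intro!: mult_right_mono powr_mono2)
qed

lemma summable_mittag_leffler:
  fixes a b s :: real
  assumes "a > 0"
  shows "summable (\<lambda>k. s ^ k / Gamma (a * real k + b))"
proof -
  \<comment> \<open>With this \<open>M\<close>, a factor \<open>M powr a\<close> per term beats \<open>\<bar>s\<bar>\<close> by at least two.\<close>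
  define M where "M = (2 * (\<bar>s\<bar> + 1)) powr (1 / a)"
  have M: "M > 0" "M powr a = 2 * (\<bar>s\<bar> + 1)"
    using assms by (auto simp: M_def powr_powr)
  define K where "K = exp M * M powr (1 - b)"
  obtain N :: nat where N: "(1 - b) / a \<le> real N"
    using real_arch_simple by blast
  show ?thesis
  proof (rule summable_comparison_test'[where N = N])
    show "summable (\<lambda>k. K * (1 / 2) ^ k)"
      by (intro summable_mult summable_geometric) auto
    fix k assume "N \<le> k"
    then have "(1 - b) / a \<le> real k"
      using N by linarith
    then have "1 \<le> a * real k + b"
      using assms by (simp add: field_simps)
    then have "M powr (a * real k + b - 1) * exp (- M) \<le> Gamma (a * real k + b)"
      using M by (intro Gamma_real_lower_bound) auto
    moreover have "M powr (a * real k + b - 1) * exp (- M) = (2 * (\<bar>s\<bar> + 1)) ^ k / K"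
    proof -
      have "M powr (a * real k + b - 1) = (M powr a) powr real k / M powr (1 - b)"
        by (simp add: powr_powr flip: powr_diff) (simp add: algebra_simps)
      then show ?thesis
        unfolding M(2) K_def by (simp add: powr_realpow exp_minus field_simps)
    qed
    moreover have K: "K > 0" using M by (simp add: K_def)
    ultimately have le: "(2 * (\<bar>s\<bar> + 1)) ^ k / K \<le> Gamma (a * real k + b)"
      by simp
    have pos: "0 < (2 * (\<bar>s\<bar> + 1)) ^ k / K" using K by simp
    have "norm (s ^ k / Gamma (a * real k + b)) = \<bar>s\<bar> ^ k / Gamma (a * real k + b)"
      using le pos by (simp add: power_abs)
    also have "\<dots> \<le> \<bar>s\<bar> ^ k / ((2 * (\<bar>s\<bar> + 1)) ^ k / K)"
      using le pos by (intro divide_left_mono mult_pos_pos) auto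
    also have "\<dots> = K * (\<bar>s\<bar> / (2 * (\<bar>s\<bar> + 1))) ^ k"
      by (simp add: power_divide)
    also have "\<dots> \<le> K * (1 / 2) ^ k"
      using K by (intro mult_left_mono power_mono) (auto simp: field_simps)
    finally show "norm (s ^ k / Gamma (a * real k + b)) \<le> K * (1 / 2) ^ k" .
  qed
qed

lemma summable_abs_mittag_leffler:
  fixes a b s :: real
  assumes "a > 0" "b \<ge> 0"
  shows "summable (\<lambda>k. \<bar>s ^ k / Gamma (a * real k + b)\<bar>)"
proof -
  have "0 \<le> Gamma (a * real k + b)" for k
  proof (cases "a * real k + b = 0")
    case False
    then have "0 < a * real k + b"
      using assms mult_nonneg_nonneg[of a "real k"] by linarith
    then show ?thesis by (simp add: less_imp_le)
  qed simp
  then show ?thesis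
    using summable_mittag_leffler[OF assms(1), of "\<bar>s\<bar>" b] by (simp add: power_abs)
qed

lemma mittag_leffler_0: "mittag_leffler a b 0 = 1 / Gamma b"
  using powser_zero[of "\<lambda>k. 1 / Gamma (a * real k + b)"] by (simp add: mittag_leffler_def)

lemma mittag_leffler_1_1: "mittag_leffler 1 1 s = exp s"
proof -
  have "(1 + 1 * real k) = of_nat (Suc k)" for k by simp
  then show ?thesis
    unfolding mittag_leffler_def exp_def by (simp add: Gamma_fact divide_inverse mult.commute add.commute)
qed

lemma Gamma_real_plus1:
  fixes z :: real
  assumes "0 < z"
  shows "Gamma (z + 1) = z * Gamma z"
  using assms by (intro Gamma_plus1) (auto elim!: nonpos_Ints_cases)

lemma has_field_derivative_mittag_leffler:
  fixes a b s :: real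
  assumes "a > 0"
  shows "\<exists>D. (mittag_leffler a b has_field_derivative D) (at s)"
proof -
  have "summable (\<lambda>k. 1 / Gamma (a * real k + b) * (\<bar>s\<bar> + 1) ^ k)"
    using summable_mittag_leffler[OF assms, of "\<bar>s\<bar> + 1" b] by simp
  from termdiffs_strong[OF this, of s] obtain D where
    "((\<lambda>x. \<Sum>k. 1 / Gamma (a * real k + b) * x ^ k) has_field_derivative D) (at s)" by auto
  then show ?thesis
    unfolding mittag_leffler_def by auto
qed

lemma has_field_derivative_mittag_leffler_1:
  fixes a s :: real
  assumes "a > 0"
  shows "(mittag_leffler a 1 has_field_derivative mittag_leffler a a s / a) (at s)"
proof -
  have "diffs (\<lambda>k. 1 / Gamma (a * real k + 1)) k = 1 / Gamma (a * real k + a) / a" for k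
  proof -
    have "a * real k + a > 0" using assms by (simp add: add_nonneg_pos)
    then have "Gamma (a * real k + a + 1) = (a * real k + a) * Gamma (a * real k + a)"
      by (rule Gamma_real_plus1)
    moreover have "a * real k + a = a * real (Suc k)" by (simp add: algebra_simps)
    ultimately have "Gamma (a * real (Suc k) + 1) = (a * real (Suc k)) * Gamma (a * real k + a)" by metis
    then show ?thesis
      using assms unfolding diffs_def by (simp del: of_nat_Suc)
  qed
  moreover have "summable (\<lambda>k. 1 / Gamma (a * real k + 1) * (\<bar>s\<bar> + 1) ^ k)"
    using summable_mittag_leffler[OF assms, of "\<bar>s\<bar> + 1" 1] by simp
  from termdiffs_strong[OF this, of s]
  have "((\<lambda>x. \<Sum>k. 1 / Gamma (a * real k + 1) * x ^ k) has_field_derivative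
         (\<Sum>k. diffs (\<lambda>k. 1 / Gamma (a * real k + 1)) k * s ^ k)) (at s)" by simp
  moreover have "(\<Sum>k. s ^ k / Gamma (a * real k + a) / a) = (\<Sum>k. s ^ k / Gamma (a * real k + a)) / a"
    by (intro suminf_divide summable_mittag_leffler assms)
  ultimately show ?thesis
    unfolding mittag_leffler_def by (simp add: field_simps)
qed

text \<open>Bernoulli's inequality for \<open>p \<ge> 1\<close>, and \<open>x \<le> x powr p\<close> for \<open>p \<le> 1\<close>; the linear bound makes
  \<open>(1 - x powr p) * (1 - x) powr (- a)\<close> continuous at \<open>x = 1\<close>.\<close>
lemma one_minus_powr_le:
  fixes x p :: real
  assumes "0 \<le> x" "x \<le> 1" "p > 0"
  shows "1 - x powr p \<le> max 1 p * (1 - x)"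
proof (cases "p \<ge> 1")
  case True
  show ?thesis
  proof (cases "x = 0")
    case False
    then have x: "x > 0" using assms by simp
    have "1 - 1 / x \<le> ln x"
      using ln_le_minus_one[of "1 / x"] x by (simp add: ln_div)
    then have "1 + (p - 1) * (1 - 1 / x) \<le> 1 + (p - 1) * ln x"
      using True by (intro add_left_mono mult_left_mono) auto
    also have "\<dots> \<le> x powr (p - 1)"
      using x exp_ge_add_one_self[of "(p - 1) * ln x"] by (simp add: powr_def)
    finally have "x * (1 + (p - 1) * (1 - 1 / x)) \<le> x * x powr (p - 1)"
      using x by (intro mult_left_mono) auto
    also have "\<dots> = x powr p"
      using x powr_mult_base[of x "p - 1"] by simp
    finally have "x * (1 + (p - 1) * (1 - 1 / x)) \<le> x powr p" .
    moreover have "x * (1 + (p - 1) * (1 - 1 / x)) = 1 - p * (1 - x)"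
      using x by (simp add: field_simps)
    ultimately show ?thesis using True by (simp add: max_def)
  qed (use True in simp)
next
  case False
  have "x \<le> x powr p"
    using assms False powr_mono'[of p 1 x] by (cases "x = 0") auto
  then show ?thesis using False by simp
qed

text \<open>Up to a multiple of the Beta integrand, the function to be integrated is the derivative of
  \<open>F x = (1 - x powr p) * (1 - x) powr (- a)\<close>, which drops from \<open>1\<close> to \<open>0\<close> on \<open>[0,1]\<close>. Writing
  \<open>p\<close> rather than \<open>p - 1\<close> in \<open>F\<close> keeps it continuous at \<open>0\<close> although \<open>x powr (p - 1)\<close> may blow up
  there. For \<open>p = a\<close> the value \<open>Gamma 0 = 0\<close> turns the quotient into \<open>0\<close>, the correct value of
  \<open>1/\<Gamma>\<close> at its zero.\<close>
lemma has_integral_marchaud_power_unit: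
  fixes a p :: real
  assumes a: "0 < a" "a < 1" and p: "a \<le> p"
  shows "((\<lambda>x. a * (1 - x) powr (- a - 1) * (1 - x powr (p - 1)))
          has_integral Gamma (1 - a) * Gamma p / Gamma (p - a) - 1) {0..1}"
proof -
  have p0: "p > 0" using a p by simp
  define F where "F x = (1 - x powr p) * (1 - x) powr (- a)" for x :: real
  define F' where "F' x = (1 - x powr p) * (a * (1 - x) powr (- a - 1))
      - p * x powr (p - 1) * (1 - x) powr (- a)" for x
  have "(F' has_integral F 1 - F 0) {0..1}"
  proof (rule fundamental_theorem_of_calculus_interior)
    show "continuous_on {0..1} F"
      unfolding continuous_on_def
    proof
      fix x :: real assume x: "x \<in> {0..1}"
      show "(F \<longlongrightarrow> F x) (at x within {0..1})"
      proof (cases "x = 1")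
        case True
        have "((\<lambda>y. max 1 p * (1 - y) powr (1 - a)) \<longlongrightarrow> max 1 p * (1 - 1) powr (1 - a)) (at x within {0..1})"
          unfolding True using a
          by (intro tendsto_intros tendsto_powr') (auto simp: eventually_at_filter)
        then have lim: "((\<lambda>y. max 1 p * (1 - y) powr (1 - a)) \<longlongrightarrow> 0) (at x within {0..1})"
          by simp
        have bound: "norm (F y) \<le> max 1 p * (1 - y) powr (1 - a)" if "y \<in> {0..1}" for y
        proof -
          have "norm (F y) = (1 - y powr p) * (1 - y) powr (- a)"
            using that p0 by (simp add: F_def abs_mult powr_le1)
          also have "\<dots> \<le> (max 1 p * (1 - y)) * (1 - y) powr (- a)"
            using that p0 by (intro mult_right_mono one_minus_powr_le) auto
          also have "\<dots> = max 1 p * (1 - y) powr (1 - a)"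
            using that powr_mult_base[of "1 - y" "- a"] by (simp add: mult.assoc)
          finally show ?thesis .
        qed
        have "(F \<longlongrightarrow> 0) (at x within {0..1})"
          by (rule Lim_null_comparison[OF _ lim])
             (use bound in \<open>auto simp: eventually_at_filter\<close>)
        moreover have "F x = 0" by (simp add: F_def True)
        ultimately show ?thesis by simp
      next
        case False
        then show ?thesis
          unfolding F_def using x p0
          by (intro tendsto_intros tendsto_powr') (auto simp: eventually_at_filter)
      qed
    qed
    fix x :: real assume "x \<in> {0<..<1}"
    then show "(F has_vector_derivative F' x) (at x)"
      unfolding F_def F'_def has_real_derivative_iff_has_vector_derivative[symmetric]
      by (auto intro!: derivative_eq_intros simp: powr_diff)
  qed auto
  then have "(F' has_integral - 1) {0..1}" using p0 by (simp add: F_def)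
  moreover have "((\<lambda>x. (p - a) * (x powr (p - 1) * (1 - x) powr (1 - a - 1)))
      has_integral (p - a) * Beta p (1 - a)) {0..1}"
    using a p0 by (intro has_integral_mult_right has_integral_Beta_real) auto
  ultimately have "((\<lambda>x. F' x + (p - a) * (x powr (p - 1) * (1 - x) powr (1 - a - 1)))
      has_integral - 1 + (p - a) * Beta p (1 - a)) {0..1}"
    by (rule has_integral_add)
  moreover have "(p - a) * Beta p (1 - a) = Gamma (1 - a) * Gamma p / Gamma (p - a)"
  proof (cases "p = a")
    case False
    then have "Gamma (p - a + 1) = (p - a) * Gamma (p - a)"
      using p by (intro Gamma_real_plus1) auto
    moreover have "p + (1 - a) = p - a + 1" by simp
    ultimately have "Gamma (p + (1 - a)) = (p - a) * Gamma (p - a)" by metis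
    then show ?thesis
      using False unfolding Beta_def by (simp add: mult.commute)
  qed simp
  ultimately have *: "((\<lambda>x. F' x + (p - a) * (x powr (p - 1) * (1 - x) powr (1 - a - 1)))
      has_integral Gamma (1 - a) * Gamma p / Gamma (p - a) - 1) (cbox 0 1)" by simp
  have "((\<lambda>x. a * (1 - x) powr (- a - 1) * (1 - x powr (p - 1)))
          has_integral Gamma (1 - a) * Gamma p / Gamma (p - a) - 1) (cbox 0 1)"
  proof (rule has_integral_spike_interior[OF *])
    fix x :: real assume "x \<in> box 0 1"
    then have x: "0 < x" "x < 1" by auto
    have 1: "x powr p = x * x powr (p - 1)"
      using x powr_mult_base[of x "p - 1"] by simp
    have 2: "(1 - x) powr (- a) = (1 - x) * (1 - x) powr (- a - 1)"
      using x powr_mult_base[of "1 - x" "- a - 1"] by simp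
    have 3: "1 - a - 1 = - a" by simp
    show "a * (1 - x) powr (- a - 1) * (1 - x powr (p - 1)) =
        F' x + (p - a) * (x powr (p - 1) * (1 - x) powr (1 - a - 1))"
      unfolding F'_def 3 1 2 by (simp add: algebra_simps)
  qed
  then show ?thesis by simp
qed

text \<open>Scaling to \<open>(0,t)\<close>. The integral of the absolute value is needed as well, because it controls the
  termwise integration of power series.\<close>
lemma marchaud_power:
  fixes a p t :: real
  assumes a: "0 < a" "a < 1" and p: "a \<le> p" and t: "t > 0"
  defines "f \<equiv> \<lambda>s. a * (t - s) powr (- a - 1) * (t powr (p - 1) - s powr (p - 1))"
  defines "J \<equiv> t powr (p - 1 - a) * (Gamma (1 - a) * Gamma p / Gamma (p - a) - 1)"
  shows "set_integrable lebesgue {0<..<t} f"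
    and "(LINT s:{0<..<t}|lebesgue. f s) = J"
    and "(LINT s:{0<..<t}|lebesgue. \<bar>f s\<bar>) = \<bar>J\<bar>"
proof -
  define g where "g = (\<lambda>x. a * (1 - x) powr (- a - 1) * (1 - x powr (p - 1)))"
  have "((\<lambda>s. g (1 / t * s)) has_integral
      (1 / \<bar>1 / t\<bar>) *\<^sub>R (Gamma (1 - a) * Gamma p / Gamma (p - a) - 1)) ((\<lambda>x. x / (1 / t)) ` {0..1})"
    unfolding g_def
    by (intro has_integral_stretch_real has_integral_marchaud_power_unit assms) (use t in auto)
  moreover have "(\<lambda>x. x / (1 / t)) ` {0..1} = {0..t}"
    using t image_divide_atLeastAtMost[of "1 / t" 0 1] by simp
  ultimately have "((\<lambda>s. g (s / t)) has_integral
      t * (Gamma (1 - a) * Gamma p / Gamma (p - a) - 1)) {0..t}" using t by simp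
  then have "((\<lambda>s. t powr (p - 2 - a) * g (s / t)) has_integral
      t powr (p - 2 - a) * (t * (Gamma (1 - a) * Gamma p / Gamma (p - a) - 1))) {0<..<t}"
    unfolding has_integral_Icc_iff_Ioo by (rule has_integral_mult_right)
  moreover have "t powr (p - 2 - a) * (t * (Gamma (1 - a) * Gamma p / Gamma (p - a) - 1)) = J"
    using t powr_mult_base[of t "p - 2 - a"] by (simp add: J_def algebra_simps)
  moreover have "t powr (p - 2 - a) * g (s / t) = f s" if "s \<in> {0<..<t}" for s
  proof -
    have 1: "(1 - s / t) powr (- a - 1) = (t - s) powr (- a - 1) / t powr (- a - 1)"
      using that t powr_divide[of "t - s" t "- a - 1"] by (simp add: field_simps)
    have 2: "(s / t) powr (p - 1) = s powr (p - 1) / t powr (p - 1)"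
      using that t by (simp add: powr_divide)
    have 3: "t powr (p - 2 - a) = t powr (- a - 1) * t powr (p - 1)"
      by (simp flip: powr_add) (simp add: algebra_simps)
    have "t powr (- a - 1) \<noteq> 0" "t powr (p - 1) \<noteq> 0" using t by auto
    then show ?thesis
      unfolding f_def g_def 1 2 3 by (simp add: divide_simps)
  qed
  ultimately have hi: "(f has_integral J) {0<..<t}"
    by (metis (no_types, lifting) has_integral_cong)
  \<comment> \<open>Since \<open>s powr (p - 1)\<close> is monotone in \<open>s\<close>, \<open>f\<close> has constant sign, so absolute
    integrability follows from integrability.\<close>
  have key: "set_integrable lebesgue {0<..<t} f \<and> (LINT s:{0<..<t}|lebesgue. \<bar>f s\<bar>) = \<bar>J\<bar>"
  proof (cases "p \<ge> 1")
    case True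
    then have nn: "0 \<le> f s" if "s \<in> {0<..<t}" for s
      using that a by (auto simp: f_def intro!: mult_nonneg_nonneg powr_mono2)
    have *: "set_integrable lebesgue {0<..<t} f"
      using hi nn by (intro nonnegative_absolutely_integrable_1) (auto simp: has_integral_integrable)
    have "(LINT s:{0<..<t}|lebesgue. \<bar>f s\<bar>) = (LINT s:{0<..<t}|lebesgue. f s)"
      using nn by (intro set_lebesgue_integral_cong) auto
    also have "\<dots> = J"
      using set_lebesgue_integral_eq_integral[OF *] hi by (simp add: integral_unique)
    moreover have "0 \<le> J" using hi nn has_integral_nonneg by blast
    ultimately show ?thesis using * by simp
  next
    case False
    have nn: "0 \<le> - f s" if "s \<in> {0<..<t}" for s
    proof -
      have "t powr (p - 1) \<le> s powr (p - 1)"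
        using that False by (intro powr_mono2') auto
      then show ?thesis using a by (auto simp: f_def mult_nonneg_nonpos)
    qed
    have hi': "((\<lambda>s. - f s) has_integral - J) {0<..<t}" using hi by (rule has_integral_neg)
    have *: "set_integrable lebesgue {0<..<t} (\<lambda>s. - f s)"
      using hi' nn by (intro nonnegative_absolutely_integrable_1) (auto simp: has_integral_integrable)
    have **: "set_integrable lebesgue {0<..<t} f"
      using set_integrable_mult_right[of "-1" lebesgue "{0<..<t}" "\<lambda>s. - f s"] * by simp
    have "(LINT s:{0<..<t}|lebesgue. \<bar>f s\<bar>) = (LINT s:{0<..<t}|lebesgue. - f s)"
      using nn by (intro set_lebesgue_integral_cong) auto
    also have "\<dots> = - J"
      using set_lebesgue_integral_eq_integral(2)[OF *] integral_unique[OF hi'] by simp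
    moreover have "0 \<le> - J" using hi' nn has_integral_nonneg by blast
    ultimately show ?thesis using ** by simp
  qed
  then show "set_integrable lebesgue {0<..<t} f" "(LINT s:{0<..<t}|lebesgue. \<bar>f s\<bar>) = \<bar>J\<bar>"
    by auto
  show "(LINT s:{0<..<t}|lebesgue. f s) = J"
    using set_lebesgue_integral_eq_integral[of "{0<..<t}" f] key hi by (simp add: integral_unique)
qed

section \<open>Relaxation functions and their positivity\<close>

lemma mittag_leffler_shift:
  fixes a b z :: real
  assumes "a > 0"
  shows "mittag_leffler a b z = 1 / Gamma b + z * mittag_leffler a (a + b) z"
proof -
  have "mittag_leffler a b z = (\<Sum>k. z ^ Suc k / Gamma (a * real (Suc k) + b)) + 1 / Gamma b"
    unfolding mittag_leffler_def
    using suminf_split_head[OF summable_mittag_leffler[OF assms, of z b]] by simp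
  also have "(\<Sum>k. z ^ Suc k / Gamma (a * real (Suc k) + b)) =
      (\<Sum>k. z * (z ^ k / Gamma (a * real k + (a + b))))"
    by (simp add: algebra_simps)
  also have "\<dots> = z * mittag_leffler a (a + b) z"
    unfolding mittag_leffler_def
    by (rule suminf_mult[OF summable_mittag_leffler[OF assms]])
  finally show ?thesis by simp
qed

text \<open>The function \<open>G\<^sub>b\<close> of the introduction: \<open>b = 1\<close> gives the solution of the fractional relaxation
  equation \<open>D\<^bsup>a\<^esup> y = - c y\<close>, and \<open>b = a\<close> gives, up to the factor \<open>- c\<close>, its derivative. Because
  \<open>0 powr 0 = 0\<close>, the value for \<open>b = 1\<close> at \<open>t = 0\<close> is \<open>0\<close> and not \<open>1\<close>.\<close>
definition relaxation :: "real \<Rightarrow> real \<Rightarrow> real \<Rightarrow> real \<Rightarrow> real" where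
  "relaxation a b c t = t powr (b - 1) * mittag_leffler a b (- c * t powr a)"

text \<open>The offset \<open>d\<close> covers both the terms of the series (\<open>d = 0\<close>) and those of its fractional
  derivative (\<open>d = a\<close>).\<close>
lemma relaxation_term:
  fixes a b c t :: real
  assumes "t > 0"
  shows "(- c) ^ k / Gamma (a * real k + b) * t powr (a * real k + b - 1 - d)
    = t powr (b - 1 - d) * ((- c * t powr a) ^ k / Gamma (a * real k + b))"
proof -
  have "t powr (a * real k + b - 1 - d) = (t powr a) powr real k * t powr (b - 1 - d)"
    by (simp add: powr_powr flip: powr_add) (simp add: algebra_simps)
  moreover have "(- c * t powr a) ^ k = (- c) ^ k * (t powr a) ^ k"
    by (rule power_mult_distrib)
  ultimately show ?thesis
    using assms by (simp add: powr_realpow)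
qed

lemma relaxation_sums:
  fixes a b c t :: real
  assumes "a > 0" "t > 0"
  shows "(\<lambda>k. (- c) ^ k / Gamma (a * real k + b) * t powr (a * real k + b - 1)) sums relaxation a b c t"
proof -
  have "(\<lambda>k. (- c) ^ k / Gamma (a * real k + b) * t powr (a * real k + b - 1)) =
      (\<lambda>k. t powr (b - 1) * ((- c * t powr a) ^ k / Gamma (a * real k + b)))"
    using relaxation_term[OF assms(2), of c _ a b 0] by (simp only: diff_zero)
  moreover have "(\<lambda>k. t powr (b - 1) * ((- c * t powr a) ^ k / Gamma (a * real k + b))) sums relaxation a b c t"
    unfolding relaxation_def mittag_leffler_def
    by (intro sums_mult summable_sums summable_mittag_leffler assms)
  ultimately show ?thesis by (simp only:)
qed

lemma relaxation_summable_abs: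
  fixes a b c t :: real
  assumes "a > 0" "b \<ge> 0" "t > 0"
  shows "summable (\<lambda>k. \<bar>(- c) ^ k / Gamma (a * real k + b) * t powr (a * real k + b - 1)\<bar>)"
proof -
  have "(\<lambda>k. \<bar>(- c) ^ k / Gamma (a * real k + b) * t powr (a * real k + b - 1)\<bar>) =
      (\<lambda>k. t powr (b - 1) * \<bar>(- c * t powr a) ^ k / Gamma (a * real k + b)\<bar>)"
    using relaxation_term[OF assms(3), of c _ a b 0] by (simp only: diff_zero abs_mult abs_of_nonneg[OF powr_ge_zero])
  moreover have "summable (\<lambda>k. t powr (b - 1) * \<bar>(- c * t powr a) ^ k / Gamma (a * real k + b)\<bar>)"
    by (intro summable_mult summable_abs_mittag_leffler assms)
  ultimately show ?thesis by (simp only:)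
qed

text \<open>Each power is integrated by \<open>marchaud_power\<close>. After division by \<open>Gamma (a * k + b)\<close> the
  results form the two Mittag-Leffler series with parameters \<open>b\<close> and \<open>b - a\<close>; the first cancels the
  boundary term \<open>t powr (- a) * relaxation a b c t\<close>, and the index shift \<open>mittag_leffler_shift\<close>
  brings the second back to parameter \<open>b\<close>. Sum and integral may be interchanged because the
  integrals of the absolute values of the terms are dominated by absolutely convergent
  Mittag-Leffler series.\<close>
lemma marchaud_relaxation:
  fixes a b c t :: real
  assumes a: "0 < a" "a < 1" and b: "a \<le> b" and t: "t > 0"
  defines "f \<equiv> \<lambda>s. a * (t - s) powr (- a - 1) * (relaxation a b c t - relaxation a b c s)"
  shows "set_integrable lebesgue {0<..<t} f"
    and "t powr (- a) * relaxation a b c t + (LINT s:{0<..<t}|lebesgue. f s)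
      = Gamma (1 - a) * (t powr (b - 1 - a) / Gamma (b - a) - c * relaxation a b c t)"
proof -
  define p where "p k = a * real k + b" for k :: nat
  define \<gamma> where "\<gamma> k = (- c) ^ k / Gamma (p k)" for k
  define z where "z = - c * t powr a"
  define h where "h k s = a * (t - s) powr (- a - 1) * (t powr (p k - 1) - s powr (p k - 1))" for k s
  define J where "J k = t powr (p k - 1 - a) * (Gamma (1 - a) * Gamma (p k) / Gamma (p k - a) - 1)" for k
  have p: "a \<le> p k" "0 < p k" for k
  proof -
    have "0 \<le> a * real k" using a by simp
    then show "a \<le> p k" "0 < p k" using a b unfolding p_def by linarith+
  qed
  have h: "set_integrable lebesgue {0<..<t} (h k)" "(LINT s:{0<..<t}|lebesgue. h k s) = J k"
    "(LINT s:{0<..<t}|lebesgue. \<bar>h k s\<bar>) = \<bar>J k\<bar>" for k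
    using marchaud_power[OF a p(1) t] unfolding h_def J_def by auto
  define u where "u k s = indicator {0<..<t} s *\<^sub>R (\<gamma> k * h k s)" for k s
  have \<gamma>J: "\<gamma> k * J k = t powr (b - 1 - a) *
      (Gamma (1 - a) * (z ^ k / Gamma (a * real k + (b - a))) - z ^ k / Gamma (a * real k + b))" for k
  proof -
    have "Gamma (p k) \<noteq> 0" using Gamma_real_pos[OF p(2)[of k]] by simp
    then have "\<gamma> k * J k = Gamma (1 - a) * ((- c) ^ k / Gamma (p k - a) * t powr (p k - 1 - a))
        - (- c) ^ k / Gamma (p k) * t powr (p k - 1 - a)"
      by (simp add: \<gamma>_def J_def algebra_simps)
    also have "(- c) ^ k / Gamma (p k) * t powr (p k - 1 - a) = t powr (b - 1 - a) * (z ^ k / Gamma (a * real k + b))"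
      unfolding p_def z_def by (rule relaxation_term[OF t])
    also have "(- c) ^ k / Gamma (p k - a) * t powr (p k - 1 - a)
        = t powr (b - 1 - a) * (z ^ k / Gamma (a * real k + (b - a)))"
      using relaxation_term[OF t, of c k a "b - a" 0] unfolding p_def z_def by (simp add: algebra_simps)
    finally show ?thesis by (simp add: algebra_simps)
  qed
  have u_int: "integrable lebesgue (u k)" for k
    using h(1)[of k] unfolding u_def set_integrable_def[symmetric] by simp
  have u_lint: "(\<integral>s. u k s \<partial>lebesgue) = \<gamma> k * J k" for k
    using h(2)[of k] unfolding u_def set_lebesgue_integral_def[symmetric] by simp
  have u_norm: "(\<integral>s. norm (u k s) \<partial>lebesgue) = \<bar>\<gamma> k * J k\<bar>" for k
  proof -
    have "(\<integral>s. norm (u k s) \<partial>lebesgue) = (LINT s:{0<..<t}|lebesgue. \<bar>\<gamma> k\<bar> * \<bar>h k s\<bar>)"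
      unfolding u_def set_lebesgue_integral_def by (intro Bochner_Integration.integral_cong) (auto simp: abs_mult)
    then show ?thesis using h(3)[of k] by (simp add: abs_mult)
  qed
  have "summable (\<lambda>k. \<bar>\<gamma> k * J k\<bar>)"
  proof (rule summable_comparison_test')
    show "summable (\<lambda>k. t powr (b - 1 - a) *
        (Gamma (1 - a) * \<bar>z ^ k / Gamma (a * real k + (b - a))\<bar> + \<bar>z ^ k / Gamma (a * real k + b)\<bar>))"
      using a b by (intro summable_mult summable_add summable_abs_mittag_leffler) auto
    fix k :: nat
    show "norm \<bar>\<gamma> k * J k\<bar> \<le> t powr (b - 1 - a) *
        (Gamma (1 - a) * \<bar>z ^ k / Gamma (a * real k + (b - a))\<bar> + \<bar>z ^ k / Gamma (a * real k + b)\<bar>)"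
    proof -
      have "\<bar>Gamma (1 - a) * x - y\<bar> \<le> Gamma (1 - a) * \<bar>x\<bar> + \<bar>y\<bar>" for x y
        using a abs_triangle_ineq4[of "Gamma (1 - a) * x" y] by (simp add: abs_mult)
      then have "\<bar>t powr (b - 1 - a) * (Gamma (1 - a) * x - y)\<bar>
          \<le> t powr (b - 1 - a) * (Gamma (1 - a) * \<bar>x\<bar> + \<bar>y\<bar>)" for x y
        unfolding abs_mult abs_of_nonneg[OF powr_ge_zero] by (rule mult_left_mono) simp
      then show ?thesis
        unfolding \<gamma>J abs_abs real_norm_def .
    qed
  qed
  then have sum_norm: "summable (\<lambda>k. \<integral>s. norm (u k s) \<partial>lebesgue)"
    unfolding u_norm .
  have u_abs: "summable (\<lambda>k. norm (u k s))" for s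
  proof (cases "s \<in> {0<..<t}")
    case True
    show ?thesis
    proof (rule summable_comparison_test')
      show "summable (\<lambda>k. a * (t - s) powr (- a - 1) *
          (\<bar>\<gamma> k * t powr (p k - 1)\<bar> + \<bar>\<gamma> k * s powr (p k - 1)\<bar>))"
        using a b t True unfolding \<gamma>_def p_def
        by (intro summable_mult summable_add relaxation_summable_abs) auto
      fix k :: nat
      have "\<bar>\<gamma> k * h k s\<bar> = a * (t - s) powr (- a - 1) * \<bar>\<gamma> k * t powr (p k - 1) - \<gamma> k * s powr (p k - 1)\<bar>"
        using a by (simp add: h_def abs_mult flip: right_diff_distrib)
      also have "\<dots> \<le> a * (t - s) powr (- a - 1) * (\<bar>\<gamma> k * t powr (p k - 1)\<bar> + \<bar>\<gamma> k * s powr (p k - 1)\<bar>)"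
        using a by (intro mult_left_mono) auto
      finally show "norm (norm (u k s)) \<le> a * (t - s) powr (- a - 1) *
          (\<bar>\<gamma> k * t powr (p k - 1)\<bar> + \<bar>\<gamma> k * s powr (p k - 1)\<bar>)"
        using True by (simp add: u_def)
    qed
  qed (simp add: u_def)
  have u_sum: "(\<Sum>k. u k s) = indicator {0<..<t} s *\<^sub>R f s" for s
  proof (cases "s \<in> {0<..<t}")
    case True
    have "(\<lambda>k. a * (t - s) powr (- a - 1) * (\<gamma> k * t powr (p k - 1) - \<gamma> k * s powr (p k - 1))) sums f s"
      unfolding f_def \<gamma>_def p_def using a t True
      by (intro sums_mult sums_diff relaxation_sums) auto
    then have "(\<lambda>k. u k s) sums f s"
      using True by (simp add: u_def h_def algebra_simps)
    then show ?thesis using True by (simp add: sums_iff)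
  qed (simp add: u_def)
  show "set_integrable lebesgue {0<..<t} f"
    using integrable_suminf[OF u_int AE_I2 sum_norm] u_abs unfolding u_sum set_integrable_def by simp
  have "(\<lambda>k. \<integral>s. u k s \<partial>lebesgue) sums (\<integral>s. (\<Sum>k. u k s) \<partial>lebesgue)"
    using sums_integral[OF u_int AE_I2 sum_norm] u_abs by simp
  then have "(\<lambda>k. \<gamma> k * J k) sums (LINT s:{0<..<t}|lebesgue. f s)"
    unfolding u_lint u_sum set_lebesgue_integral_def .
  moreover have "(\<lambda>k. \<gamma> k * J k) sums (t powr (b - 1 - a) *
      (Gamma (1 - a) * mittag_leffler a (b - a) z - mittag_leffler a b z))"
    unfolding \<gamma>J mittag_leffler_def using a
    by (intro sums_mult sums_diff summable_sums summable_mittag_leffler) auto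
  ultimately have "(LINT s:{0<..<t}|lebesgue. f s) = t powr (b - 1 - a) *
      (Gamma (1 - a) * mittag_leffler a (b - a) z - mittag_leffler a b z)"
    by (rule sums_unique2)
  also have "mittag_leffler a (b - a) z = 1 / Gamma (b - a) + z * mittag_leffler a b z"
    using mittag_leffler_shift[OF a(1), of "b - a" z] by simp
  finally have L: "(LINT s:{0<..<t}|lebesgue. f s) = t powr (b - 1 - a) *
      (Gamma (1 - a) * (1 / Gamma (b - a) + z * mittag_leffler a b z) - mittag_leffler a b z)" .
  have 1: "t powr (- a) * relaxation a b c t = t powr (b - 1 - a) * mittag_leffler a b z"
    by (simp add: relaxation_def z_def mult.assoc[symmetric] flip: powr_add)
  have 2: "t powr (b - 1 - a) * (z * mittag_leffler a b z) = - c * relaxation a b c t"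
  proof -
    have "t powr (b - 1) = t powr (b - 1 - a) * t powr a" by (simp flip: powr_add)
    then show ?thesis by (simp add: relaxation_def z_def)
  qed
  show "t powr (- a) * relaxation a b c t + (LINT s:{0<..<t}|lebesgue. f s)
      = Gamma (1 - a) * (t powr (b - 1 - a) / Gamma (b - a) - c * relaxation a b c t)"
  proof -
    have "t powr (- a) * relaxation a b c t + (LINT s:{0<..<t}|lebesgue. f s)
      = Gamma (1 - a) * (t powr (b - 1 - a) / Gamma (b - a) + t powr (b - 1 - a) * (z * mittag_leffler a b z))"
      unfolding L 1 by (simp add: algebra_simps)
    then show ?thesis unfolding 2 by simp
  qed
qed

lemma set_integrable_uminus:
  fixes f :: "'a \<Rightarrow> real"
  assumes "set_integrable M A f"
  shows "set_integrable M A (\<lambda>x. - f x)"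
  using integrable_minus[OF assms[unfolded set_integrable_def]] by (simp add: set_integrable_def)

lemma set_lebesgue_integral_pos:
  fixes f :: "real \<Rightarrow> real"
  assumes int: "set_integrable lebesgue {0<..<t} f" and t: "0 < t"
    and pos: "\<And>s. s \<in> {0<..<t} \<Longrightarrow> 0 < f s"
  shows "0 < (LINT s:{0<..<t}|lebesgue. f s)"
proof -
  define F where "F s = indicator {0<..<t} s *\<^sub>R f s" for s
  have F: "integrable lebesgue F" using int unfolding set_integrable_def F_def .
  have F0: "AE s in lebesgue. 0 \<le> F s"
    using pos by (intro AE_I2) (auto simp: F_def indicator_def intro: less_imp_le)
  have "integral\<^sup>L lebesgue F \<noteq> 0"
  proof
    assume "integral\<^sup>L lebesgue F = 0"
    then have "AE s in lebesgue. F s = 0"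
      using integral_nonneg_eq_0_iff_AE[OF F F0] by simp
    then have "AE s in lebesgue. s \<notin> {0<..<t}"
    proof (rule AE_mp, intro AE_I2 impI)
      fix s assume "F s = 0"
      then show "s \<notin> {0<..<t}" using pos[of s] by (auto simp: F_def)
    qed
    then have "{0<..<t} \<in> null_sets lebesgue"
      by (subst AE_iff_null_sets) auto
    then show False using t by (auto simp: null_sets_def)
  qed
  moreover have "0 \<le> integral\<^sup>L lebesgue F" using F0 by (rule integral_nonneg_AE)
  ultimately show ?thesis unfolding set_lebesgue_integral_def F_def[symmetric] by simp
qed

lemma continuous_mittag_leffler:
  assumes "a > 0"
  shows "continuous_on A (mittag_leffler a b)"
proof -
  have "isCont (mittag_leffler a b) s" for s
    using has_field_derivative_mittag_leffler[OF assms, of b s] DERIV_isCont by blast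
  then show ?thesis by (simp add: continuous_at_imp_continuous_on)
qed

lemma continuous_mittag_leffler_powr:
  fixes a b c :: real
  assumes "a > 0" "A \<subseteq> {0..}"
  shows "continuous_on A (\<lambda>t. mittag_leffler a b (- c * t powr a))"
  using assms
  by (intro continuous_on_compose2[OF continuous_mittag_leffler] continuous_on_mult continuous_on_powr')
     (auto intro!: continuous_intros)

text \<open>At a first point \<open>t0\<close> where the relaxation function \<open>R\<close> fails to be positive, \<open>R t0 - R s < 0\<close> for
  all \<open>s < t0\<close>, so the left-hand side of \<open>marchaud_relaxation\<close> is negative, while \<open>b \<ge> a\<close> and
  \<open>c \<ge> 0\<close> make the right-hand side nonnegative.\<close>
lemma mittag_leffler_pos:
  fixes a b c t :: real
  assumes a: "0 < a" "a < 1" and b: "a \<le> b" and c: "c \<ge> 0" and t: "t \<ge> 0"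
  shows "0 < mittag_leffler a b (- c * t powr a)"
proof (rule ccontr)
  define M where "M t = mittag_leffler a b (- c * t powr a)" for t
  assume "\<not> 0 < mittag_leffler a b (- c * t powr a)"
  then have Mt: "M t \<le> 0" by (simp add: M_def)
  have contM: "continuous_on {0..t} M"
    unfolding M_def using a by (intro continuous_mittag_leffler_powr) auto
  define Z where "Z = {x \<in> {0..t}. M x \<le> 0}"
  have "compact Z"
    unfolding compact_eq_bounded_closed Z_def using contM
    by (intro conjI continuous_on_closed_Collect_le bounded_subset[OF bounded_closed_interval[of 0 t]])
       (auto intro!: continuous_intros)
  moreover have "t \<in> Z" using t Mt by (simp add: Z_def)
  ultimately obtain t0 where t0: "t0 \<in> Z" and min: "\<And>x. x \<in> Z \<Longrightarrow> t0 \<le> x"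
    using compact_attains_inf[of Z] by blast
  have "M 0 > 0"
    using a b by (simp add: M_def mittag_leffler_0)
  then have pos: "t0 > 0" and M0: "M t0 \<le> 0"
    using t0 by (auto simp: Z_def less_le)
  have Ms: "0 < M s" if "0 \<le> s" "s < t0" for s
    using min[of s] that t0 by (force simp: Z_def)
  define R where "R = relaxation a b c"
  have R0: "R t0 \<le> 0"
    using M0 by (simp add: R_def relaxation_def M_def mult_nonneg_nonpos)
  have Rs: "0 < R s" if "s \<in> {0<..<t0}" for s
    using Ms[of s] that by (simp add: R_def relaxation_def M_def)
  let ?f = "\<lambda>s. a * (t0 - s) powr (- a - 1) * (R t0 - R s)"
  note mr = marchaud_relaxation[OF a b pos, of c, folded R_def]
  have "0 < (LINT s:{0<..<t0}|lebesgue. - ?f s)"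
  proof (rule set_lebesgue_integral_pos)
    show "set_integrable lebesgue {0<..<t0} (\<lambda>s. - ?f s)"
      using mr(1) by (rule set_integrable_uminus)
    fix s assume s: "s \<in> {0<..<t0}"
    then have "R t0 - R s < 0" using R0 Rs[of s] by simp
    then show "0 < - ?f s" using a s by (simp add: mult_pos_neg)
  qed fact
  moreover have "(LINT s:{0<..<t0}|lebesgue. - ?f s) = - (LINT s:{0<..<t0}|lebesgue. ?f s)"
    by (simp add: set_lebesgue_integral_def)
  ultimately have "(LINT s:{0<..<t0}|lebesgue. ?f s) < 0" by simp
  moreover have "t0 powr (- a) * R t0 \<le> 0"
    using R0 by (simp add: mult_nonneg_nonpos)
  moreover have "0 \<le> Gamma (1 - a) * (t0 powr (b - 1 - a) / Gamma (b - a) - c * R t0)"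
  proof -
    have "0 \<le> Gamma (b - a)" using b by (cases "b = a") (auto intro: less_imp_le)
    moreover have "c * R t0 \<le> 0" using c R0 by (simp add: mult_nonneg_nonpos)
    ultimately show ?thesis
      using a by (intro mult_nonneg_nonneg) (auto intro!: less_imp_le add_nonneg_nonneg simp: diff_conv_add_uminus simp del: add_uminus_conv_diff)
  qed
  ultimately show False using mr(2) by linarith
qed

section \<open>The Caputo derivative and the minimum principle\<close>

text \<open>A divergent Lebesgue integral has value \<open>0\<close> and a missing derivative an arbitrary one, so the
  value \<open>caputo_deriv T a y t\<close> carries information only under this condition.\<close>
definition caputo_exists :: "real \<Rightarrow> real \<Rightarrow> (real \<Rightarrow> real) \<Rightarrow> real \<Rightarrow> bool" where
  "caputo_exists T a y t \<longleftrightarrow>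
    (if a = 1 then y differentiable (at t within {0<..T})
     else set_integrable lebesgue {0<..<t} (\<lambda>s. a * (t - s) powr (- a - 1) * (y t - y s)))"

lemma at_within_half_open_nontrivial:
  fixes t T :: real
  assumes "t \<in> {0<..T}"
  shows "at t within {0<..T} \<noteq> bot"
proof -
  have "t islimpt {0<..<t}" using assms by (intro islimpt_greaterThanLessThan2) auto
  then have "t islimpt {0<..T}" by (rule islimpt_subset) (use assms in auto)
  then show ?thesis by (simp add: trivial_limit_within)
qed

lemma caputo_linear:
  fixes y z :: "real \<Rightarrow> real"
  assumes t: "t \<in> {0<..T}" and y: "caputo_exists T a y t" and z: "caputo_exists T a z t"
  shows "caputo_exists T a (\<lambda>s. y s + k * z s) t"
    and "caputo_deriv T a (\<lambda>s. y s + k * z s) t = caputo_deriv T a y t + k * caputo_deriv T a z t"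
proof -
  have "caputo_exists T a (\<lambda>s. y s + k * z s) t \<and>
    caputo_deriv T a (\<lambda>s. y s + k * z s) t = caputo_deriv T a y t + k * caputo_deriv T a z t"
  proof (cases "a = 1")
    case True
    let ?F = "at t within {0<..T}"
    have "(y has_vector_derivative vector_derivative y ?F) ?F"
      "(z has_vector_derivative vector_derivative z ?F) ?F"
      using y z True by (simp_all add: caputo_exists_def vector_derivative_works)
    then have "((\<lambda>s. y s + k * z s) has_vector_derivative
        vector_derivative y ?F + k * vector_derivative z ?F) ?F"
      by (auto intro!: derivative_eq_intros)
    then show ?thesis
      using True vector_derivative_within[OF at_within_half_open_nontrivial[OF t]]
      by (auto simp: caputo_exists_def caputo_deriv_def intro: differentiableI_vector)
  next
    case False
    let ?I = "\<lambda>y s. a * (t - s) powr (- a - 1) * (y t - y s)"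
    have split: "?I (\<lambda>s. y s + k * z s) = (\<lambda>s. ?I y s + k * ?I z s)"
      by (auto simp: algebra_simps)
    have iy: "set_integrable lebesgue {0<..<t} (?I y)" and iz: "set_integrable lebesgue {0<..<t} (?I z)"
      using y z False by (auto simp: caputo_exists_def)
    have ikz: "set_integrable lebesgue {0<..<t} (\<lambda>s. k * ?I z s)"
      using iz by (rule set_integrable_mult_right)
    have "set_integrable lebesgue {0<..<t} (?I (\<lambda>s. y s + k * z s))"
      unfolding split using iy ikz by (rule set_integral_add)
    moreover have "(LINT s:{0<..<t}|lebesgue. ?I (\<lambda>s. y s + k * z s) s) =
        (LINT s:{0<..<t}|lebesgue. ?I y s) + k * (LINT s:{0<..<t}|lebesgue. ?I z s)"
      using set_integral_add(2)[OF iy ikz] unfolding split by simp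
    ultimately show ?thesis
      using False by (simp add: caputo_exists_def caputo_deriv_def algebra_simps add_divide_distrib diff_divide_distrib)
  qed
  then show "caputo_exists T a (\<lambda>s. y s + k * z s) t"
    and "caputo_deriv T a (\<lambda>s. y s + k * z s) t = caputo_deriv T a y t + k * caputo_deriv T a z t"
    by auto
qed

lemma set_lebesgue_integral_nonneg:
  fixes f :: "real \<Rightarrow> real"
  assumes "\<And>s. s \<in> A \<Longrightarrow> 0 \<le> f s"
  shows "0 \<le> (LINT s:A|M. f s)"
  unfolding set_lebesgue_integral_def
  by (rule Bochner_Integration.integral_nonneg) (auto simp: indicator_def assms)

lemma caputo_deriv_nonpos:
  fixes u :: "real \<Rightarrow> real"
  assumes a: "0 < a" "a \<le> 1" and t: "t \<in> {0<..T}" and u: "caputo_exists T a u t"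
    and min: "\<And>s. s \<in> {0..<t} \<Longrightarrow> u t \<le> u s"
  shows "caputo_deriv T a u t \<le> 0"
proof (cases "a = 1")
  case True
  define D where "D = vector_derivative u (at t within {0<..T})"
  have "(u has_vector_derivative D) (at t within {0<..T})"
    using u True by (simp add: caputo_exists_def D_def vector_derivative_works)
  then have "(u has_vector_derivative D) (at t within {0<..<t})"
    by (rule has_vector_derivative_within_subset) (use t in auto)
  then have lim: "((\<lambda>s. (u s - u t) / (s - t)) \<longlongrightarrow> D) (at t within {0<..<t})"
    by (simp add: has_real_derivative_iff_has_vector_derivative[symmetric] has_field_derivative_iff)
  have "D \<le> 0"
  proof (rule tendsto_upperbound[OF lim])
    show "\<forall>\<^sub>F s in at t within {0<..<t}. (u s - u t) / (s - t) \<le> 0"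
      unfolding eventually_at_filter
      by (rule always_eventually) (auto intro!: divide_nonneg_nonpos min)
    show "at t within {0<..<t} \<noteq> bot"
      using t islimpt_greaterThanLessThan2[of 0 t] by (simp add: trivial_limit_within)
  qed
  then show ?thesis using True by (simp add: caputo_deriv_def D_def)
next
  case False
  have "0 \<le> (LINT s:{0<..<t}|lebesgue. - (a * (t - s) powr (- a - 1) * (u t - u s)))"
    using a min by (intro set_lebesgue_integral_nonneg) (auto simp: mult_nonneg_nonpos)
  moreover have "\<dots> = - (LINT s:{0<..<t}|lebesgue. a * (t - s) powr (- a - 1) * (u t - u s))"
    by (simp add: set_lebesgue_integral_def)
  moreover have "t powr (- a) * (u t - u 0) \<le> 0"
    using min[of 0] t by (intro mult_nonneg_nonpos) auto
  moreover have "0 < Gamma (1 - a)" using a False by simp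
  ultimately show ?thesis
    using False by (simp add: caputo_deriv_def divide_nonpos_pos)
qed

lemma set_borel_measurable_continuous_lebesgue:
  fixes f :: "real \<Rightarrow> real"
  assumes "A \<in> sets borel" "continuous_on A f"
  shows "set_borel_measurable lebesgue A f"
  using borel_measurable_continuous_on_indicator[OF assms]
  unfolding set_borel_measurable_def by (intro measurable_completion) simp

text \<open>The Lipschitz bound at \<open>t\<close> compensates one power of the singularity \<open>(t - s) powr (- a - 1)\<close>. It
  is required near \<open>t\<close> only: boundedness extends it to the whole interval with a larger constant.\<close>
lemma caputo_exists_lipschitz:
  fixes y :: "real \<Rightarrow> real"
  assumes a: "0 < a" "a < 1" and t: "t > 0"
    and cont: "continuous_on {0..t} y" and d: "d > 0" and L: "0 \<le> L"
    and lip: "\<And>s. s \<in> {0<..<t} \<Longrightarrow> t - s < d \<Longrightarrow> \<bar>y t - y s\<bar> \<le> L * (t - s)"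
  shows "caputo_exists T a y t"
proof -
  obtain B where B: "\<And>s. s \<in> {0..t} \<Longrightarrow> \<bar>y s\<bar> \<le> B"
    using compact_imp_bounded[OF compact_continuous_image[OF cont compact_Icc]]
    unfolding bounded_iff by (metis image_eqI real_norm_def)
  have B0: "0 \<le> B" using B[of t] t by force
  define K where "K = L + 2 * B / d"
  have K: "\<bar>y t - y s\<bar> \<le> K * (t - s)" if s: "s \<in> {0<..<t}" for s
  proof (cases "t - s < d")
    case True
    have "\<bar>y t - y s\<bar> \<le> L * (t - s)" by (rule lip[OF s True])
    also have "\<dots> \<le> K * (t - s)"
      using s d B0 unfolding K_def by (intro mult_right_mono) auto
    finally show ?thesis .
  next
    case False
    have "\<bar>y t - y s\<bar> \<le> 2 * B" using B[of t] B[of s] s t by auto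
    also have "\<dots> \<le> 2 * B / d * (t - s)"
      using False d B0 mult_left_mono[of d "t - s" "2 * B"] by (simp add: field_simps)
    also have "\<dots> \<le> K * (t - s)"
      using s L unfolding K_def by (intro mult_right_mono) auto
    finally show ?thesis .
  qed
  \<comment> \<open>Up to the factor \<open>K\<close>, the dominating function is the integrand of the power \<open>s powr 1\<close>.\<close>
  have "set_integrable lebesgue {0<..<t} (\<lambda>s. a * (t - s) powr (- a - 1) * (t powr (2 - 1) - s powr (2 - 1)))"
    using a t by (intro marchaud_power) auto
  then have int: "set_integrable lebesgue {0<..<t} (\<lambda>s. K * (a * (t - s) powr (- a - 1) * (t powr (2 - 1) - s powr (2 - 1))))"
    by (rule set_integrable_mult_right)
  have "set_integrable lebesgue {0<..<t} (\<lambda>s. a * (t - s) powr (- a - 1) * (y t - y s))"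
  proof (rule set_integrable_bound[OF int])
    show "set_borel_measurable lebesgue {0<..<t} (\<lambda>s. a * (t - s) powr (- a - 1) * (y t - y s))"
      by (intro set_borel_measurable_continuous_lebesgue continuous_intros
          continuous_on_subset[OF cont]) auto
    show "AE s in lebesgue. s \<in> {0<..<t} \<longrightarrow> norm (a * (t - s) powr (- a - 1) * (y t - y s))
        \<le> norm (K * (a * (t - s) powr (- a - 1) * (t powr (2 - 1) - s powr (2 - 1))))"
    proof (intro AE_I2 impI)
      fix s assume s: "s \<in> {0<..<t}"
      have "\<bar>y t - y s\<bar> \<le> \<bar>K * (t - s)\<bar>" using K[OF s] by linarith
      then have "a * (t - s) powr (- a - 1) * \<bar>y t - y s\<bar> \<le> a * (t - s) powr (- a - 1) * \<bar>K * (t - s)\<bar>"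
        using a by (intro mult_left_mono) auto
      then show "norm (a * (t - s) powr (- a - 1) * (y t - y s))
        \<le> norm (K * (a * (t - s) powr (- a - 1) * (t powr (2 - 1) - s powr (2 - 1))))"
        using a s t by (simp add: abs_mult mult_ac)
    qed
  qed
  then show ?thesis using a by (simp add: caputo_exists_def)
qed

lemma caputo_exists_differentiable:
  fixes y :: "real \<Rightarrow> real"
  assumes a: "0 < a" "a \<le> 1" and t: "t > 0"
    and cont: "continuous_on {0..t} y" and deriv: "(y has_real_derivative D) (at t)"
  shows "caputo_exists T a y t"
proof (cases "a = 1")
  case True
  then show ?thesis
    using has_field_derivative_at_within[OF deriv]
    by (auto simp: caputo_exists_def real_differentiable_def)
next
  case False
  have "((\<lambda>s. (y s - y t) / (s - t)) \<longlongrightarrow> D) (at t)"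
    using deriv by (simp add: has_field_derivative_iff)
  from tendstoD[OF this zero_less_one] obtain d where d: "d > 0"
    and near: "\<And>s. s \<noteq> t \<Longrightarrow> \<bar>s - t\<bar> < d \<Longrightarrow> \<bar>(y s - y t) / (s - t) - D\<bar> < 1"
    by (auto simp: eventually_at dist_real_def)
  have "\<bar>y t - y s\<bar> \<le> (\<bar>D\<bar> + 1) * (t - s)" if s: "s \<in> {0<..<t}" "t - s < d" for s
  proof -
    have "\<bar>(y s - y t) / (s - t) - D\<bar> < 1" using near[of s] s by auto
    then have "\<bar>(y s - y t) / (s - t)\<bar> \<le> \<bar>D\<bar> + 1" by linarith
    then show ?thesis
      using s by (simp add: abs_divide field_simps abs_minus_commute)
  qed
  then show ?thesis
    using a False t cont d by (intro caputo_exists_lipschitz[where d = d and L = "\<bar>D\<bar> + 1"]) auto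
qed

lemma caputo_deriv_id_pos:
  assumes a: "0 < a" "a \<le> 1" and t: "t \<in> {0<..T}"
  shows "0 < caputo_deriv T a (\<lambda>s. s) t"
proof (cases "a = 1")
  case True
  have "vector_derivative (\<lambda>s. s) (at t within {0<..T}) = 1"
    by (intro vector_derivative_within[OF at_within_half_open_nontrivial[OF t]] has_vector_derivative_id)
  then show ?thesis using True by (simp add: caputo_deriv_def)
next
  case False
  have "0 \<le> (LINT s:{0<..<t}|lebesgue. a * (t - s) powr (- a - 1) * (t - s))"
    using a by (intro set_lebesgue_integral_nonneg) auto
  moreover have "0 < t powr (- a) * (t - 0)" using t by simp
  ultimately have "0 < t powr (- a) * (t - 0) + (LINT s:{0<..<t}|lebesgue. a * (t - s) powr (- a - 1) * (t - s))"
    by linarith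
  then show ?thesis using a False by (simp add: caputo_deriv_def)
qed

text \<open>Minimum principle. If \<open>u\<close> were negative somewhere, then for small \<open>e > 0\<close> also \<open>u s + e * s\<close> would
  have a negative minimum, at some \<open>t > 0\<close>. There all its Caputo derivatives are \<open>\<le> 0\<close>, and
  subtracting those of \<open>e * s\<close>, which are positive, leaves \<open>caputo_deriv T (\<alpha> i) u t < 0\<close> for all
  \<open>i\<close>. Without the perturbation the sum could vanish, for instance if only a first-order term is present and
  \<open>lam = 0\<close>.\<close>
lemma multiterm_nonneg:
  fixes u :: "real \<Rightarrow> real"
  assumes T: "T > 0" and \<alpha>: "\<And>i. i \<in> {1..l} \<Longrightarrow> 0 < \<alpha> i \<and> \<alpha> i \<le> 1"
    and q: "\<And>i t. i \<in> {1..l} \<Longrightarrow> t \<in> {0..T} \<Longrightarrow> 0 \<le> q i t"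
    and qpos: "\<And>t. t \<in> {0..T} \<Longrightarrow> 0 < (\<Sum>i=1..l. q i t)"
    and lam: "0 \<le> lam"
    and cont: "continuous_on {0..T} u" and u0: "0 \<le> u 0"
    and ex: "\<And>i t. i \<in> {1..l} \<Longrightarrow> t \<in> {0<..T} \<Longrightarrow> caputo_exists T (\<alpha> i) u t"
    and super: "\<And>t. t \<in> {0<..T} \<Longrightarrow> 0 \<le> multiterm_deriv T l \<alpha> q u t + lam * u t"
    and t1: "t1 \<in> {0..T}"
  shows "0 \<le> u t1"
proof (rule ccontr)
  assume "\<not> 0 \<le> u t1"
  then have neg: "u t1 < 0" by simp
  \<comment> \<open>Small enough that \<open>e * t1 \<le> - u t1 / 2\<close> keeps the value at \<open>t1\<close> negative.\<close>
  define e where "e = - u t1 / (2 * T)"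
  have e: "e > 0" using neg T unfolding e_def by (intro divide_pos_pos) auto
  define U where "U s = u s + e * s" for s
  have "e * t1 \<le> e * T" using e t1 by simp
  also have "\<dots> = - u t1 / 2" using T by (simp add: e_def)
  finally have Ut1: "U t1 < 0" using neg by (simp add: U_def)
  have "continuous_on {0..T} U" unfolding U_def using cont by (intro continuous_intros)
  then obtain t where t: "t \<in> {0..T}" and min: "\<And>s. s \<in> {0..T} \<Longrightarrow> U t \<le> U s"
    using continuous_attains_inf[of "{0..T}" U] T by auto
  have Ut: "U t < 0" using min[OF t1] Ut1 by simp
  then have t': "t \<in> {0<..T}" using t u0 by (cases "t = 0") (auto simp: U_def)
  have ut: "u t < 0" 
  proof -
    have "0 < e * t" using e t' by simp
    then show ?thesis using Ut unfolding U_def by linarith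
  qed
  have neg_i: "caputo_deriv T (\<alpha> i) u t < 0" if i: "i \<in> {1..l}" for i
  proof -
    have a: "0 < \<alpha> i" "\<alpha> i \<le> 1" using \<alpha>[OF i] by auto
    have id: "caputo_exists T (\<alpha> i) (\<lambda>s. s) t"
      using a t' by (intro caputo_exists_differentiable[where D = 1]) (auto intro!: derivative_eq_intros)
    note lin = caputo_linear[OF t' ex[OF i t'] id, of e, folded U_def]
    have "caputo_deriv T (\<alpha> i) U t \<le> 0"
      using a t' lin(1) min by (intro caputo_deriv_nonpos) auto
    moreover have "0 < e * caputo_deriv T (\<alpha> i) (\<lambda>s. s) t"
      using e caputo_deriv_id_pos[OF a t'] by simp
    ultimately show ?thesis using lin(2) by linarith
  qed
  obtain i where i: "i \<in> {1..l}" "0 < q i t"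
    using qpos[OF t] sum_nonpos[of "{1..l}" "\<lambda>i. q i t"] by (meson not_le)
  have "(\<Sum>i=1..l. q i t * caputo_deriv T (\<alpha> i) u t) < (\<Sum>i=1..l. 0)"
  proof (rule sum_strict_mono_ex1)
    show "\<forall>i\<in>{1..l}. q i t * caputo_deriv T (\<alpha> i) u t \<le> 0"
      using q[OF _ t] less_imp_le[OF neg_i] by (intro ballI mult_nonneg_nonpos)
    show "\<exists>i\<in>{1..l}. q i t * caputo_deriv T (\<alpha> i) u t < 0"
      using i neg_i[OF i(1)] by (intro bexI[of _ i] mult_pos_neg)
  qed simp
  then have "multiterm_deriv T l \<alpha> q u t < 0" by (simp add: multiterm_deriv_def)
  moreover have "lam * u t \<le> 0" using lam ut by (simp add: mult_nonneg_nonpos)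
  ultimately show False using super[OF t'] by simp
qed

text \<open>This agrees with \<open>relaxation a 1 c\<close> on \<open>t > 0\<close> and, unlike it, takes the right value \<open>1\<close> at \<open>t = 0\<close>.\<close>
definition relaxation_solution :: "real \<Rightarrow> real \<Rightarrow> real \<Rightarrow> real" where
  "relaxation_solution a c t = mittag_leffler a 1 (- c * t powr a)"

lemma continuous_relaxation_solution: "0 < a \<Longrightarrow> A \<subseteq> {0..} \<Longrightarrow> continuous_on A (relaxation_solution a c)"
  unfolding relaxation_solution_def by (rule continuous_mittag_leffler_powr)

lemma relaxation_solution_0: "relaxation_solution a c 0 = 1"
  by (simp add: relaxation_solution_def mittag_leffler_0)

lemma has_field_derivative_relaxation_solution:
  fixes a c t :: real
  assumes "0 < a" "0 < t"
  shows "(relaxation_solution a c has_real_derivative - c * relaxation a a c t) (at t)"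
proof -
  have "((\<lambda>t. - c * t powr a) has_real_derivative - c * (a * t powr (a - 1))) (at t)"
    using assms by (auto intro!: derivative_eq_intros simp: powr_diff)
  from DERIV_chain2[OF has_field_derivative_mittag_leffler_1[OF assms(1)] this]
  show ?thesis
    unfolding relaxation_solution_def using assms by (simp add: relaxation_def mult_ac)
qed

lemma mittag_leffler_nonneg:
  fixes a b c t :: real
  assumes "0 < a" "a < 1 \<or> b = 1 \<and> a = 1" "a \<le> b" "0 \<le> c" "0 \<le> t"
  shows "0 \<le> mittag_leffler a b (- c * t powr a)"
  using assms mittag_leffler_pos[of a b c t] by (auto simp: mittag_leffler_1_1)

text \<open>The derivative is \<open>- c * relaxation a a c t\<close>, which is nonpositive by the positivity result for \<open>b = a\<close>.\<close>
lemma relaxation_solution_antimono: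
  fixes a c s t :: real
  assumes a: "0 < a" "a \<le> 1" and c: "0 \<le> c" and st: "0 \<le> s" "s \<le> t"
  shows "relaxation_solution a c t \<le> relaxation_solution a c s"
proof (rule DERIV_nonpos_imp_decreasing_open[OF st(2)])
  fix x assume x: "s < x" "x < t"
  have "0 \<le> relaxation a a c x"
    using a c x st unfolding relaxation_def by (intro mult_nonneg_nonneg mittag_leffler_nonneg) auto
  then show "\<exists>D. (relaxation_solution a c has_real_derivative D) (at x) \<and> D \<le> 0"
    using has_field_derivative_relaxation_solution[OF a(1), of x c] c x st by (auto simp: mult_nonneg_nonneg)
qed (use a st in \<open>auto intro!: continuous_relaxation_solution\<close>)

lemma caputo_deriv_relaxation_solution:
  fixes a c t :: real
  assumes a: "0 < a" "a \<le> 1" and t: "t \<in> {0<..T}"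
  shows "caputo_deriv T a (relaxation_solution a c) t = - c * relaxation_solution a c t"
proof -
  have R: "relaxation a 1 c s = relaxation_solution a c s" if "s > 0" for s
    using that by (simp add: relaxation_def relaxation_solution_def)
  show ?thesis
  proof (cases "a = 1")
    case True
    have "(relaxation_solution a c has_real_derivative - c * relaxation a a c t) (at t within {0<..T})"
      using has_field_derivative_at_within[OF has_field_derivative_relaxation_solution[OF a(1)]] t by simp
    then have "vector_derivative (relaxation_solution a c) (at t within {0<..T}) = - c * relaxation a a c t"
      by (intro vector_derivative_within[OF at_within_half_open_nontrivial[OF t]])
         (simp add: has_real_derivative_iff_has_vector_derivative)
    moreover have "relaxation a a c t = relaxation_solution a c t" using True R t by auto
    ultimately show ?thesis using True by (simp add: caputo_deriv_def)
  next
    case False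
    then have a1: "a < 1" using a by simp
    have "0 < Gamma (1 - a)" using a1 by simp
    then have G: "Gamma (1 - a) \<noteq> 0" by linarith
    have pos: "0 < t" using t by simp
    define I where "I = (LINT s:{0<..<t}|lebesgue. a * (t - s) powr (- a - 1) * (relaxation_solution a c t - relaxation_solution a c s))"
    have "(LINT s:{0<..<t}|lebesgue. a * (t - s) powr (- a - 1) * (relaxation a 1 c t - relaxation a 1 c s)) = I"
      unfolding I_def
    proof (rule set_lebesgue_integral_cong)
      show "\<forall>s. s \<in> {0<..<t} \<longrightarrow> a * (t - s) powr (- a - 1) * (relaxation a 1 c t - relaxation a 1 c s)
          = a * (t - s) powr (- a - 1) * (relaxation_solution a c t - relaxation_solution a c s)"
        using R[OF pos] R by (metis greaterThanLessThan_iff)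
    qed simp
    then have "t powr (- a) * relaxation_solution a c t + I
        = Gamma (1 - a) * (t powr (- a) / Gamma (1 - a) - c * relaxation_solution a c t)"
      using marchaud_relaxation(2)[OF a(1) a1 a(2) pos, of c] unfolding R[OF pos] by simp
    also have "\<dots> = t powr (- a) - Gamma (1 - a) * (c * relaxation_solution a c t)"
      using G by (simp add: right_diff_distrib)
    finally have "t powr (- a) * (relaxation_solution a c t - relaxation_solution a c 0) + I = Gamma (1 - a) * (- c * relaxation_solution a c t)"
      unfolding relaxation_solution_0 by (simp add: right_diff_distrib)
    then have "caputo_deriv T a (relaxation_solution a c) t = Gamma (1 - a) * (- c * relaxation_solution a c t) / Gamma (1 - a)"
      using False unfolding caputo_deriv_def I_def by simp
    then show ?thesis
      using G by simp
  qed
qed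

section \<open>Bounded weak derivatives and Lipschitz continuity\<close>

text \<open>For \<open>p = 1\<close> and \<open>k = 0\<close> this is the standard bump \<open>exp (- 1 / (1 - x\<^sup>2))\<close>. The polynomial and the
  power of \<open>1 / (1 - x\<^sup>2)\<close> make the family closed under differentiation, so that smoothness needs a
  single derivative computation.\<close>
definition bump :: "real poly \<Rightarrow> nat \<Rightarrow> real \<Rightarrow> real" where
  "bump p k x = (if \<bar>x\<bar> < 1 then poly p x * (1 / (1 - x^2)) ^ k * exp (- (1 / (1 - x^2))) else 0)"

lemma bump_outside: "1 \<le> \<bar>x\<bar> \<Longrightarrow> bump p k x = 0"
  by (simp add: bump_def)

lemma power_le_fact_exp:
  fixes r :: real
  assumes "0 \<le> r"
  shows "r ^ n * exp (- r) \<le> fact n"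
proof -
  have "(\<Sum>k\<in>{n}. r ^ k /\<^sub>R fact k) \<le> (\<Sum>k. r ^ k /\<^sub>R fact k)"
    using assms by (intro sum_le_suminf sums_summable[OF exp_converges]) auto
  also have "\<dots> = exp r" by (rule sums_unique[OF exp_converges, symmetric])
  finally show ?thesis
    by (simp add: exp_minus field_simps)
qed

text \<open>Quadratic decay towards the end points, and hence derivative \<open>0\<close> there: the exponential beats every
  power of \<open>1 / (1 - y\<^sup>2)\<close>.\<close>
lemma bump_bound:
  obtains C where "0 \<le> C" "\<And>x y. 1 \<le> \<bar>x\<bar> \<Longrightarrow> \<bar>bump p k y\<bar> \<le> C * (y - x)\<^sup>2"
proof -
  have "bounded (poly p ` {-1..1})"
    by (intro compact_imp_bounded compact_continuous_image continuous_intros compact_Icc)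
  then obtain B where "\<forall>z\<in>poly p ` {-1..1}. norm z \<le> B"
    unfolding bounded_iff by blast
  then have B: "\<bar>poly p y\<bar> \<le> B" if "\<bar>y\<bar> \<le> 1" for y
    using that by (auto simp: abs_le_iff)
  have B0: "0 \<le> B" using B[of 0] by simp
  define C where "C = B * fact (k + 2) * 4"
  have C0: "0 \<le> C" using B0 by (simp add: C_def)
  have "\<bar>bump p k y\<bar> \<le> C * (y - x)\<^sup>2" if x: "1 \<le> \<bar>x\<bar>" for x y
  proof (cases "\<bar>y\<bar> < 1")
    case True
    define d where "d = 1 - y\<^sup>2"
    have "\<bar>y\<bar> * \<bar>y\<bar> < 1 * 1" using True by (intro mult_strict_mono) auto
    then have d: "0 < d" unfolding d_def by (simp add: power2_eq_square)
    have "(1 / d) ^ (k + 2) * exp (- (1 / d)) \<le> fact (k + 2)"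
      using d by (intro power_le_fact_exp) auto
    moreover have "(1 / d) ^ (k + 2) = (1 / d) ^ k / d\<^sup>2"
      by (simp add: power_add power_divide power2_eq_square)
    ultimately have 1: "(1 / d) ^ k * exp (- (1 / d)) \<le> fact (k + 2) * d\<^sup>2"
      using d by (simp add: divide_simps power2_eq_square del: fact_Suc)
    have "d = (1 - \<bar>y\<bar>) * (1 + \<bar>y\<bar>)"
      by (simp add: d_def algebra_simps power2_eq_square)
    also have "\<dots> \<le> (1 - \<bar>y\<bar>) * 2" using True by (intro mult_left_mono) auto
    also have "\<dots> \<le> 2 * \<bar>y - x\<bar>" using x abs_triangle_ineq2[of x y] by (simp add: abs_minus_commute)
    finally have "d\<^sup>2 \<le> (2 * \<bar>y - x\<bar>)\<^sup>2" using d by (intro power_mono) auto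
    then have 2: "d\<^sup>2 \<le> 4 * (y - x)\<^sup>2" by (simp add: power_mult_distrib)
    have "\<bar>bump p k y\<bar> = \<bar>poly p y\<bar> * ((1 / d) ^ k * exp (- (1 / d)))"
      using True d unfolding bump_def d_def[symmetric] by (simp add: abs_mult power_abs)
    also have "\<dots> \<le> B * (fact (k + 2) * d\<^sup>2)"
      using mult_mono[OF B[of y] 1] True d B0 by simp
    also have "\<dots> \<le> B * (fact (k + 2) * (4 * (y - x)\<^sup>2))"
      using B0 2 by (intro mult_left_mono) auto
    finally show ?thesis unfolding C_def by (simp only: mult_ac)
  qed (use C0 in \<open>simp add: bump_outside\<close>)
  with C0 show ?thesis by (rule that)
qed

text \<open>With \<open>r = 1 / (1 - x\<^sup>2)\<close> one has \<open>r' = 2 x r\<^sup>2\<close>; this is the polynomial that remains when the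
  derivative of \<open>p r\<^sup>k exp (- r)\<close> is written over the common factor \<open>r\<^bsup>k+2\<^esup> exp (- r)\<close>.\<close>
definition bump_diff_poly :: "real poly \<Rightarrow> nat \<Rightarrow> real poly" where
  "bump_diff_poly p k = pderiv p * [:1, 0, -1:] ^ 2
     + smult (2 * real k) ([:0, 1:] * p * [:1, 0, -1:]) - smult 2 ([:0, 1:] * p)"

lemma has_field_derivative_bump:
  "(bump p k has_real_derivative bump (bump_diff_poly p k) (k + 2) x) (at x)"
proof -
  consider "\<bar>x\<bar> < 1" | "1 < \<bar>x\<bar>" | "\<bar>x\<bar> = 1" by linarith
  then show ?thesis
  proof cases
    case 1
    define d where "d = 1 - x\<^sup>2"
    have "\<bar>x\<bar> * \<bar>x\<bar> < 1 * 1" using 1 by (intro mult_strict_mono) auto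
    then have d: "0 < d" unfolding d_def by (simp add: power2_eq_square)
    have r: "((\<lambda>y. 1 / (1 - y\<^sup>2)) has_real_derivative 2 * x * (1 / d)\<^sup>2) (at x)"
      using d unfolding d_def by (auto intro!: derivative_eq_intros simp: power2_eq_square)
    have rk: "((\<lambda>y. (1 / (1 - y\<^sup>2)) ^ k) has_real_derivative
        real k * (1 / d) ^ Suc k * (2 * x)) (at x)"
    proof (cases k)
      case (Suc n)
      then show ?thesis
        using DERIV_power[OF r, of k] by (simp add: d_def power2_eq_square mult_ac)
    qed simp
    have e: "((\<lambda>y. exp (- (1 / (1 - y\<^sup>2)))) has_real_derivative
        exp (- (1 / d)) * - (2 * x * (1 / d)\<^sup>2)) (at x)"
      using DERIV_chain2[OF DERIV_exp DERIV_minus[OF r]] unfolding d_def .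
    have "((\<lambda>y. poly p y * (1 / (1 - y\<^sup>2)) ^ k * exp (- (1 / (1 - y\<^sup>2)))) has_real_derivative
        (poly (pderiv p) x * (1 / d) ^ k + (real k * (1 / d) ^ Suc k * (2 * x)) * poly p x) * exp (- (1 / d))
        + exp (- (1 / d)) * - (2 * x * (1 / d)\<^sup>2) * (poly p x * (1 / d) ^ k)) (at x)"
      using DERIV_mult[OF DERIV_mult[OF poly_DERIV[of p x] rk] e] unfolding d_def .
    moreover have "(poly (pderiv p) x * (1 / d) ^ k + (real k * (1 / d) ^ Suc k * (2 * x)) * poly p x) * exp (- (1 / d))
        + exp (- (1 / d)) * - (2 * x * (1 / d)\<^sup>2) * (poly p x * (1 / d) ^ k)
      = bump (bump_diff_poly p k) (k + 2) x"
    proof -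
      have q: "poly (bump_diff_poly p k) x = poly (pderiv p) x * d\<^sup>2 + 2 * real k * (x * poly p x * d) - 2 * (x * poly p x)"
        by (simp add: bump_diff_poly_def d_def power2_eq_square algebra_simps)
      define r where "r = 1 / d"
      have dr: "d * r = 1" using d by (simp add: r_def)
      have 1: "r ^ k = d\<^sup>2 * r ^ (k + 2)" and 2: "r ^ Suc k = d * r ^ (k + 2)"
        using dr by (simp_all add: power_add power2_eq_square) (metis mult.assoc mult.commute mult.right_neutral)+
      have 3: "r\<^sup>2 * r ^ k = r ^ (k + 2)" by (simp add: power_add power2_eq_square)
      have "(poly (pderiv p) x * r ^ k + (real k * r ^ Suc k * (2 * x)) * poly p x) * exp (- r)
          + exp (- r) * - (2 * x * r\<^sup>2) * (poly p x * r ^ k)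
        = (poly (pderiv p) x * r ^ k + (real k * r ^ Suc k * (2 * x)) * poly p x
          - 2 * x * poly p x * (r\<^sup>2 * r ^ k)) * exp (- r)"
        by (simp add: algebra_simps)
      also have "\<dots> = poly (bump_diff_poly p k) x * r ^ (k + 2) * exp (- r)"
        unfolding q 2 3 unfolding 1 by (simp add: algebra_simps)
      finally show ?thesis
        using \<open>\<bar>x\<bar> < 1\<close> unfolding bump_def r_def d_def by simp
    qed
    ultimately have "((\<lambda>y. poly p y * (1 / (1 - y\<^sup>2)) ^ k * exp (- (1 / (1 - y\<^sup>2)))) has_real_derivative
        bump (bump_diff_poly p k) (k + 2) x) (at x)" by simp
    then show ?thesis
      by (rule has_field_derivative_transform_within_open[where S = "{-1<..<1}"])
         (use 1 in \<open>auto simp: bump_def\<close>)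
  next
    case 2
    have "((\<lambda>y. 0) has_real_derivative 0) (at x)" by simp
    then have "(bump p k has_real_derivative 0) (at x)"
      by (rule has_field_derivative_transform_within_open[where S = "- {-1..1}"])
         (use 2 in \<open>auto simp: bump_outside\<close>)
    then show ?thesis using 2 by (simp add: bump_outside)
  next
    case 3
    obtain C where C: "0 \<le> C" "\<And>y. \<bar>bump p k y\<bar> \<le> C * (y - x)\<^sup>2"
      using bump_bound[of p k] 3 by (metis order_refl)
    have "((\<lambda>y. (bump p k y - bump p k x) / (y - x)) \<longlongrightarrow> 0) (at x)"
    proof (rule Lim_null_comparison)
      show "((\<lambda>y. C * \<bar>y - x\<bar>) \<longlongrightarrow> 0) (at x)"
        by (rule tendsto_eq_intros tendsto_mult refl)+ simp_all
      show "\<forall>\<^sub>F y in at x. norm ((bump p k y - bump p k x) / (y - x)) \<le> C * \<bar>y - x\<bar>"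
        unfolding eventually_at_filter
      proof (rule always_eventually, intro allI impI)
        fix y assume "y \<noteq> x"
        then have "\<bar>bump p k y\<bar> / \<bar>y - x\<bar> \<le> C * \<bar>y - x\<bar>"
          using C(2)[of y] by (simp add: divide_le_eq power2_eq_square)
        then show "norm ((bump p k y - bump p k x) / (y - x)) \<le> C * \<bar>y - x\<bar>"
          using 3 by (simp add: bump_outside[of x])
      qed
    qed
    then show ?thesis using 3 by (simp add: has_field_derivative_iff bump_outside[of x])
  qed
qed

lemma continuous_bump: "continuous_on A (bump p k)"
  by (intro continuous_at_imp_continuous_on ballI DERIV_isCont[OF has_field_derivative_bump])

text \<open>A family of functions in which every member has its derivative in the family consists of smooth
  functions, and so do their antiderivatives. The antiderivative \<open>f\<close> is allowed because the smooth
  step below is an integral and not itself of the form \<open>bump p k\<close>.\<close>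
lemma smooth_if_derivative_closed:
  fixes f :: "real \<Rightarrow> real"
  assumes closed: "\<And>h. h \<in> S \<Longrightarrow> \<exists>h'\<in>S. \<forall>x. (h has_real_derivative h' x) (at x)"
    and f: "\<And>x. (f has_real_derivative f' x) (at x)" and f': "f' \<in> S"
  shows "(deriv ^^ n) f differentiable_on UNIV"
proof -
  have deriv_eq: "deriv h = h'" if "\<And>x. (h has_real_derivative h' x) (at x)" for h h' :: "real \<Rightarrow> real"
    using that by (intro ext DERIV_imp_deriv)
  have S: "(deriv ^^ m) f' \<in> S" for m
  proof (induction m)
    case (Suc m)
    then obtain h' where h': "h' \<in> S" "\<And>x. ((deriv ^^ m) f' has_real_derivative h' x) (at x)"
      using closed by blast
    then show ?case using deriv_eq[OF h'(2)] by simp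
  qed (use f' in simp)
  have "\<exists>h'. \<forall>x. ((deriv ^^ n) f has_real_derivative h' x) (at x)"
  proof (cases n)
    case 0
    then show ?thesis using f by auto
  next
    case (Suc m)
    then have "(deriv ^^ n) f = (deriv ^^ m) f'"
      using deriv_eq[OF f] by (simp add: funpow_swap1)
    then show ?thesis using closed[OF S[of m]] by auto
  qed
  then show ?thesis
    by (auto simp: differentiable_on_def real_differentiable_def)
qed

text \<open>The lower limit \<open>-2\<close> lies strictly to the left of the support \<open>[-1,1]\<close> of the bump, so that at every
  point either the fundamental theorem applies or the function vanishes nearby. The step is not
  normalised; its height is \<open>smooth_step 1\<close>.\<close>
definition smooth_step :: "real \<Rightarrow> real" where
  "smooth_step x = integral {-2..x} (bump 1 0)"

lemma bump_1_0_nonneg: "0 \<le> bump 1 0 x"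
  by (simp add: bump_def)

lemma smooth_step_left: "x \<le> -1 \<Longrightarrow> smooth_step x = 0"
  unfolding smooth_step_def by (intro integral_unique has_integral_is_0) (auto simp: bump_outside)

lemma has_field_derivative_smooth_step: "(smooth_step has_real_derivative bump 1 0 x) (at x)"
proof (cases "x > -2")
  case True
  have "(smooth_step has_vector_derivative bump 1 0 x) (at x within {-2..x + 1})"
    unfolding smooth_step_def using True by (intro integral_has_vector_derivative continuous_bump) auto
  then have "(smooth_step has_vector_derivative bump 1 0 x) (at x within {-2<..<x + 1})"
    by (rule has_vector_derivative_within_subset) auto
  then have "(smooth_step has_vector_derivative bump 1 0 x) (at x)"
    by (rule has_vector_derivative_within_open[THEN iffD1, rotated 2]) (use True in auto)
  then show ?thesis by (simp add: has_real_derivative_iff_has_vector_derivative)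
next
  case False
  have "((\<lambda>y. 0) has_real_derivative 0) (at x)" by simp
  then have "(smooth_step has_real_derivative 0) (at x)"
    by (rule has_field_derivative_transform_within_open[where S = "{..<-1}"])
       (use False in \<open>auto simp: smooth_step_left\<close>)
  then show ?thesis using False by (simp add: bump_outside)
qed

lemma continuous_smooth_step: "continuous_on A smooth_step"
  by (intro continuous_at_imp_continuous_on ballI DERIV_isCont[OF has_field_derivative_smooth_step])

lemma smooth_step_mono:
  assumes "x \<le> y"
  shows "smooth_step x \<le> smooth_step y"
proof (rule DERIV_nonneg_imp_nondecreasing[OF assms])
  fix s
  show "\<exists>D. (smooth_step has_real_derivative D) (at s) \<and> 0 \<le> D"
    using has_field_derivative_smooth_step bump_1_0_nonneg by blast
qed

lemma smooth_step_right:
  assumes "1 \<le> x"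
  shows "smooth_step x = smooth_step 1"
proof (cases "x = 1")
  case False
  show ?thesis
  proof (rule DERIV_isconst2[where f = smooth_step and a = 1 and b = x])
    fix y :: real assume "1 < y" "y < x"
    then show "(smooth_step has_real_derivative 0) (at y)"
      using has_field_derivative_smooth_step[of y] by (simp add: bump_outside)
  qed (use False assms in \<open>auto intro: continuous_smooth_step\<close>)
qed simp

lemma smooth_step_1_pos: "0 < smooth_step 1"
proof -
  have "smooth_step (-1) < smooth_step 1"
  proof (rule DERIV_pos_imp_increasing_open[where f = smooth_step])
    fix x :: real assume "-1 < x" "x < 1"
    then show "\<exists>D. (smooth_step has_real_derivative D) (at x) \<and> 0 < D"
      using has_field_derivative_smooth_step[of x] by (auto simp: bump_def intro!: exI[of _ "bump 1 0 x"])
  qed (auto intro: continuous_smooth_step)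
  then show ?thesis by (simp add: smooth_step_left)
qed

lemma smooth_step_nonneg: "0 \<le> smooth_step x"
proof (cases "x \<le> -1")
  case False
  then show ?thesis using smooth_step_mono[of "-1" x] smooth_step_left[of "-1"] by linarith
qed (simp add: smooth_step_left)

lemma smooth_step_le: "smooth_step x \<le> smooth_step 1"
proof (cases "x \<le> 1")
  case False
  then show ?thesis using smooth_step_right[of x] by linarith
qed (rule smooth_step_mono)

text \<open>A test function of height at most \<open>smooth_step 1\<close> that rises near \<open>x\<close> and falls near \<open>y\<close>; its
  derivative is the difference of two mollifiers.\<close>
definition plateau :: "real \<Rightarrow> real \<Rightarrow> real \<Rightarrow> real \<Rightarrow> real" where
  "plateau d x y s = smooth_step ((s - x) / d) - smooth_step ((s - y) / d)"

definition mollifier :: "real \<Rightarrow> real \<Rightarrow> real \<Rightarrow> real" where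
  "mollifier d x s = bump 1 0 ((s - x) / d) / d"

lemma has_field_derivative_smooth_step_affine:
  assumes "d > 0"
  shows "((\<lambda>s. smooth_step ((s - x) / d)) has_real_derivative mollifier d x s) (at s)"
proof -
  have "((\<lambda>s. (s - x) / d) has_real_derivative 1 / d) (at s)"
    using assms by (auto intro!: derivative_eq_intros)
  from DERIV_chain2[OF has_field_derivative_smooth_step this] show ?thesis
    by (simp add: mollifier_def)
qed

lemma has_field_derivative_plateau:
  "d > 0 \<Longrightarrow> (plateau d x y has_real_derivative mollifier d x s - mollifier d y s) (at s)"
  unfolding plateau_def by (intro DERIV_diff has_field_derivative_smooth_step_affine)

lemma plateau_bounds:
  assumes "d > 0" "x \<le> y"
  shows "0 \<le> plateau d x y s" "plateau d x y s \<le> smooth_step 1"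
    and "s \<notin> {x - d..y + d} \<Longrightarrow> plateau d x y s = 0"
proof -
  have "(s - y) / d \<le> (s - x) / d" using assms by (intro divide_right_mono) auto
  then show "0 \<le> plateau d x y s" using smooth_step_mono by (simp add: plateau_def)
  show "plateau d x y s \<le> smooth_step 1"
    using smooth_step_nonneg[of "(s - y) / d"] smooth_step_le[of "(s - x) / d"] by (simp add: plateau_def)
  assume "s \<notin> {x - d..y + d}"
  then consider "s < x - d" | "y + d < s" by force
  then show "plateau d x y s = 0"
  proof cases
    case 1
    then have "(s - x) / d \<le> -1" "(s - y) / d \<le> -1" using assms by (auto simp: field_simps)
    then show ?thesis by (simp add: plateau_def smooth_step_left)
  next
    case 2
    then have "1 \<le> (s - x) / d" "1 \<le> (s - y) / d" using assms by (auto simp: field_simps)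
    then show ?thesis 
      using smooth_step_right[of "(s - x) / d"] smooth_step_right[of "(s - y) / d"] by (simp add: plateau_def)
  qed
qed

lemma test_function_plateau:
  assumes d: "d > 0" and xy: "x \<le> y" and ab: "a < x - d" "y + d < b"
  shows "test_function a b (plateau d x y)"
proof -
  define S where "S = {\<lambda>s. A * bump p k ((s - x) / d) - A * bump p k ((s - y) / d) |A p k. True}"
  have aff: "((\<lambda>s. bump p k ((s - z) / d)) has_real_derivative
      bump (bump_diff_poly p k) (k + 2) ((s - z) / d) * (1 / d)) (at s)" for p k z s
  proof -
    have "((\<lambda>s. (s - z) / d) has_real_derivative 1 / d) (at s)"
      using d by (auto intro!: derivative_eq_intros)
    from DERIV_chain2[OF has_field_derivative_bump this] show ?thesis .
  qed
  have closed: "\<exists>h'\<in>S. \<forall>s. (h has_real_derivative h' s) (at s)" if hS: "h \<in> S" for h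
  proof -
    obtain A p k where h: "h = (\<lambda>s. A * bump p k ((s - x) / d) - A * bump p k ((s - y) / d))"
      using hS unfolding S_def by blast
    define q where "q = bump_diff_poly p k"
    have "(h has_real_derivative A / d * bump q (k + 2) ((s - x) / d) - A / d * bump q (k + 2) ((s - y) / d)) (at s)" for s
      unfolding h q_def using DERIV_diff[OF DERIV_cmult[OF aff] DERIV_cmult[OF aff]]
      by (rule DERIV_cong) simp
    moreover have "(\<lambda>s. A / d * bump q (k + 2) ((s - x) / d) - A / d * bump q (k + 2) ((s - y) / d)) \<in> S"
      unfolding S_def by (intro CollectI exI[of _ "A / d"] exI[of _ q] exI[of _ "k + 2"]) simp
    ultimately show ?thesis by (intro bexI) auto
  qed
  have mem: "(\<lambda>s. mollifier d x s - mollifier d y s) \<in> S"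
    unfolding S_def mollifier_def by (intro CollectI exI[of _ "1 / d"] exI[of _ 1] exI[of _ 0]) auto
  have smooth: "(deriv ^^ n) (plateau d x y) differentiable_on UNIV" for n
    by (rule smooth_if_derivative_closed[OF closed has_field_derivative_plateau[OF d] mem])
  have "{s. plateau d x y s \<noteq> 0} \<subseteq> {x - d..y + d}"
    using plateau_bounds(3)[OF d xy] by blast
  then have sub: "closure {s. plateau d x y s \<noteq> 0} \<subseteq> {x - d..y + d}"
    by (intro closure_minimal) auto
  then have "compact (closure {s. plateau d x y s \<noteq> 0})"
    unfolding compact_eq_bounded_closed by (auto intro: bounded_subset[OF bounded_closed_interval])
  with smooth sub ab show ?thesis
    unfolding test_function_def by auto
qed

text \<open>A mollifier has total mass \<open>smooth_step 1\<close> and lives on \<open>[x - d, x + d]\<close>, so it reproduces \<open>u x\<close> up to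
  the oscillation \<open>\<eta>\<close> of \<open>u\<close> there.\<close>
lemma mollifier_integral:
  fixes u :: "real \<Rightarrow> real"
  assumes d: "d > 0" and ab: "a < x - d" "x + d < b" and cont: "continuous_on {a<..<b} u"
    and close: "\<And>s. s \<in> {x - d..x + d} \<Longrightarrow> \<bar>u s - u x\<bar> \<le> \<eta>"
  shows "set_integrable lebesgue {a<..<b} (\<lambda>s. u s * mollifier d x s)"
    and "\<bar>(LINT s:{a<..<b}|lebesgue. u s * mollifier d x s) - smooth_step 1 * u x\<bar> \<le> smooth_step 1 * \<eta>"
proof -
  let ?I = "{x - d..x + d}"
  have zero: "mollifier d x s = 0" if "s \<notin> ?I" for s
  proof -
    have "1 \<le> \<bar>(s - x) / d\<bar>" using that d by (auto simp: abs_if field_simps)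
    then show ?thesis by (simp add: mollifier_def bump_outside)
  qed
  have contm: "continuous_on A (mollifier d x)" for A
    unfolding mollifier_def using d
    by (intro continuous_intros continuous_on_compose2[OF continuous_bump[of UNIV]]) auto
  have contu: "continuous_on ?I u" using cont by (rule continuous_on_subset) (use ab in auto)
  have ind: "indicator {a<..<b} s *\<^sub>R (u s * mollifier d x s) = indicator ?I s *\<^sub>R (u s * mollifier d x s)" for s
    using ab zero[of s] by (auto simp: indicator_def)
  have int: "set_integrable lebesgue ?I (\<lambda>s. u s * mollifier d x s)"
    by (intro absolutely_integrable_continuous_real continuous_intros contu contm)
  then show "set_integrable lebesgue {a<..<b} (\<lambda>s. u s * mollifier d x s)"
    unfolding set_integrable_def ind .
  have L: "(LINT s:{a<..<b}|lebesgue. u s * mollifier d x s) = integral ?I (\<lambda>s. u s * mollifier d x s)"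
    using set_lebesgue_integral_eq_integral(2)[OF int] unfolding set_lebesgue_integral_def ind .
  have "(mollifier d x has_integral smooth_step ((x + d - x) / d) - smooth_step ((x - d - x) / d)) ?I"
    using d has_field_derivative_at_within[OF has_field_derivative_smooth_step_affine[OF d]]
    by (intro fundamental_theorem_of_calculus) (auto simp: has_real_derivative_iff_has_vector_derivative[symmetric])
  then have m: "(mollifier d x has_integral smooth_step 1) ?I" using d by (simp add: smooth_step_left)
  have diff: "integral ?I (\<lambda>s. u s * mollifier d x s) - smooth_step 1 * u x = integral ?I (\<lambda>s. (u s - u x) * mollifier d x s)"
  proof -
    have "((\<lambda>s. u x * mollifier d x s) has_integral u x * smooth_step 1) ?I" using m by (rule has_integral_mult_right)
    moreover have "((\<lambda>s. u s * mollifier d x s) has_integral integral ?I (\<lambda>s. u s * mollifier d x s)) ?I"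
      by (intro integrable_integral set_lebesgue_integral_eq_integral(1) int)
    ultimately have "((\<lambda>s. u s * mollifier d x s - u x * mollifier d x s) has_integral
        integral ?I (\<lambda>s. u s * mollifier d x s) - u x * smooth_step 1) ?I" by (intro has_integral_diff)
    from integral_unique[OF this] show ?thesis
      by (simp only: left_diff_distrib mult.commute[of "u x" "smooth_step 1"])
  qed
  have "\<bar>integral ?I (\<lambda>s. (u s - u x) * mollifier d x s)\<bar> \<le> integral ?I (\<lambda>s. \<eta> * mollifier d x s)"
    unfolding real_norm_def[symmetric]
  proof (rule integral_norm_bound_integral)
    show "(\<lambda>s. (u s - u x) * mollifier d x s) integrable_on ?I"
      by (intro integrable_continuous_interval continuous_intros contu contm)
    show "(\<lambda>s. \<eta> * mollifier d x s) integrable_on ?I"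
      by (intro integrable_continuous_interval continuous_intros contm)
    fix s assume "s \<in> ?I"
    moreover have "0 \<le> mollifier d x s" using d by (simp add: mollifier_def bump_1_0_nonneg)
    ultimately show "norm ((u s - u x) * mollifier d x s) \<le> \<eta> * mollifier d x s"
      using close[of s] by (simp add: abs_mult mult_right_mono)
  qed
  also have "\<dots> = \<eta> * smooth_step 1" using has_integral_mult_right[OF m, of \<eta>] by (rule integral_unique)
  finally show "\<bar>(LINT s:{a<..<b}|lebesgue. u s * mollifier d x s) - smooth_step 1 * u x\<bar> \<le> smooth_step 1 * \<eta>"
    unfolding L diff by (simp add: mult.commute)
qed

text \<open>Testing with \<open>plateau d x y\<close> produces, up to the common factor \<open>m = smooth_step 1\<close>, approximately
  \<open>u x - u y\<close> on the side of \<open>u\<close>. On the side of \<open>g\<close> the bound is \<open>C m\<close> times the length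
  \<open>y - x + 2 d\<close> of the support. Letting \<open>d\<close> and the oscillation \<open>\<eta>\<close> tend to \<open>0\<close> gives the claim.\<close>
lemma weak_derivative_bounded_imp_lipschitz:
  fixes u g :: "real \<Rightarrow> real"
  assumes cont: "continuous_on {a<..<b} u" and weak: "weak_derivative a b u g"
    and bound: "AE s in lebesgue. s \<in> {a<..<b} \<longrightarrow> \<bar>g s\<bar> \<le> C" and C: "0 \<le> C"
    and xy: "a < x" "x \<le> y" "y < b"
  shows "\<bar>u y - u x\<bar> \<le> C * (y - x)"
proof (rule field_le_epsilon)
  fix e :: real assume e: "e > 0"
  define \<eta> where "\<eta> = e / 4"
  have \<eta>: "\<eta> > 0" using e by (simp add: \<eta>_def)
  have near: "\<exists>\<delta>>0. \<forall>s. \<bar>s - z\<bar> < \<delta> \<longrightarrow> \<bar>u s - u z\<bar> \<le> \<eta>" if z: "z \<in> {a<..<b}" for z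
  proof -
    have "isCont u z" using cont z by (simp add: continuous_on_eq_continuous_at)
    then have "\<forall>\<^sub>F s in at z. dist (u s) (u z) < \<eta>"
      using tendstoD[OF _ \<eta>] by (simp add: isCont_def)
    then obtain \<delta> where "\<delta> > 0" "\<And>s. s \<noteq> z \<Longrightarrow> \<bar>s - z\<bar> < \<delta> \<Longrightarrow> \<bar>u s - u z\<bar> < \<eta>"
      by (auto simp: eventually_at dist_real_def)
    then show ?thesis using \<eta> by (intro exI[of _ \<delta>]) (metis abs_zero diff_self less_imp_le)
  qed
  obtain d1 where d1: "d1 > 0" "\<And>s. \<bar>s - x\<bar> < d1 \<Longrightarrow> \<bar>u s - u x\<bar> \<le> \<eta>" using near[of x] xy by auto
  obtain d2 where d2: "d2 > 0" "\<And>s. \<bar>s - y\<bar> < d2 \<Longrightarrow> \<bar>u s - u y\<bar> \<le> \<eta>" using near[of y] xy by auto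
  \<comment> \<open>The last entry makes the excess \<open>2 * C * d\<close> from the support of the plateau at most \<open>2 * \<eta>\<close>.\<close>
  define d where "d = Min {d1 / 2, d2 / 2, (x - a) / 2, (b - y) / 2, \<eta> / (C + 1)}"
  have d: "d > 0" using d1 d2 xy \<eta> C by (simp add: d_def)
  have "d \<le> d1 / 2" "d \<le> d2 / 2" "d \<le> (x - a) / 2" "d \<le> (b - y) / 2" and dC: "d \<le> \<eta> / (C + 1)"
    unfolding d_def by (rule Min_le; simp)+
  then have d': "d < d1" "d < d2" "a < x - d" "y + d < b" using d1 d2 xy by auto
  have "C * d \<le> (C + 1) * d" using d by (simp add: algebra_simps)
  also have "\<dots> \<le> \<eta>" using dC C by (simp add: pos_le_divide_eq mult.commute)
  finally have Cd: "C * d \<le> \<eta>" .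
  define \<phi> where "\<phi> = plateau d x y"
  define m where "m = smooth_step 1"
  have m: "m > 0" by (simp add: m_def smooth_step_1_pos)
  note X = mollifier_integral[OF d, of a x b u \<eta>, folded m_def]
  note Y = mollifier_integral[OF d, of a y b u \<eta>, folded m_def]
  have X: "set_integrable lebesgue {a<..<b} (\<lambda>s. u s * mollifier d x s)"
    "\<bar>(LINT s:{a<..<b}|lebesgue. u s * mollifier d x s) - m * u x\<bar> \<le> m * \<eta>"
    using d d' xy cont d1(2) by (auto intro!: X)
  have Y: "set_integrable lebesgue {a<..<b} (\<lambda>s. u s * mollifier d y s)"
    "\<bar>(LINT s:{a<..<b}|lebesgue. u s * mollifier d y s) - m * u y\<bar> \<le> m * \<eta>"
    using d d' xy cont d2(2) by (auto intro!: Y)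
  have "test_function a b \<phi>"
    unfolding \<phi>_def using d d' xy by (intro test_function_plateau) auto
  then have "(LINT s:{a<..<b}|lebesgue. u s * deriv \<phi> s) = - (LINT s:{a<..<b}|lebesgue. g s * \<phi> s)"
    using weak by (simp add: weak_derivative_def)
  moreover have "deriv \<phi> s = mollifier d x s - mollifier d y s" for s
    unfolding \<phi>_def by (rule DERIV_imp_deriv[OF has_field_derivative_plateau[OF d]])
  ultimately have "(LINT s:{a<..<b}|lebesgue. u s * mollifier d x s) - (LINT s:{a<..<b}|lebesgue. u s * mollifier d y s)
      = - (LINT s:{a<..<b}|lebesgue. g s * \<phi> s)"
    using set_integral_diff(2)[OF X(1) Y(1)] by (simp add: right_diff_distrib)
  moreover have "\<bar>LINT s:{a<..<b}|lebesgue. g s * \<phi> s\<bar> \<le> C * m * (y - x + 2 * d)"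
  proof -
    have "\<bar>LINT s:{a<..<b}|lebesgue. g s * \<phi> s\<bar> \<le> (\<integral>s. norm (indicator {a<..<b} s *\<^sub>R (g s * \<phi> s)) \<partial>lebesgue)"
      unfolding set_lebesgue_integral_def real_norm_def[symmetric] by (rule integral_norm_bound)
    also have "\<dots> \<le> (\<integral>s. C * m * indicator {x - d..y + d} s \<partial>lebesgue)"
    proof (rule integral_mono_AE')
      show "integrable lebesgue (\<lambda>s. C * m * indicator {x - d..y + d} s)"
        by (intro integrable_mult_right integrable_real_indicator) (auto simp: emeasure_lborel_Icc_eq)
      show "AE s in lebesgue. 0 \<le> C * m * indicator {x - d..y + d} s" using C m by simp
      show "AE s in lebesgue. norm (indicator {a<..<b} s *\<^sub>R (g s * \<phi> s)) \<le> C * m * indicator {x - d..y + d} s"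
        using bound
      proof (rule AE_mp, intro AE_I2 impI)
        fix s assume s: "s \<in> {a<..<b} \<longrightarrow> \<bar>g s\<bar> \<le> C"
        note pl = plateau_bounds[OF d xy(2), of s, folded \<phi>_def m_def]
        show "norm (indicator {a<..<b} s *\<^sub>R (g s * \<phi> s)) \<le> C * m * indicator {x - d..y + d} s"
        proof (cases "s \<in> {x - d..y + d}")
          case True
          then have "\<bar>g s\<bar> \<le> C" using s d' by auto
          then have "\<bar>g s\<bar> * \<bar>\<phi> s\<bar> \<le> C * m" using pl C by (intro mult_mono) auto
          then show ?thesis using True m C by (auto simp: abs_mult indicator_def)
        qed (use pl in simp)
      qed
    qed
    also have "\<dots> = C * m * (y - x + 2 * d)"
      using d xy by simp
    finally show ?thesis .
  qed
  ultimately have "m * \<bar>u y - u x\<bar> \<le> C * m * (y - x + 2 * d) + 2 * (m * \<eta>)"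
  proof -
    have "m * \<bar>u y - u x\<bar> = \<bar>m * u y - m * u x\<bar>" using m by (simp add: abs_mult flip: right_diff_distrib)
    moreover assume "(LINT s:{a<..<b}|lebesgue. u s * mollifier d x s) - (LINT s:{a<..<b}|lebesgue. u s * mollifier d y s)
      = - (LINT s:{a<..<b}|lebesgue. g s * \<phi> s)"
      "\<bar>LINT s:{a<..<b}|lebesgue. g s * \<phi> s\<bar> \<le> C * m * (y - x + 2 * d)"
    ultimately show ?thesis using X(2) Y(2) by linarith
  qed
  also have "\<dots> = m * (C * (y - x) + 2 * (C * d) + 2 * \<eta>)" by (simp add: algebra_simps)
  also have "\<dots> \<le> m * (C * (y - x) + e)"
    using m Cd by (intro mult_left_mono) (auto simp: \<eta>_def)
  finally show "\<bar>u y - u x\<bar> \<le> C * (y - x) + e" using m by simp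
qed

text \<open>The right end point is included by continuity, since the Caputo derivative at \<open>t\<close> needs the Lipschitz
  bound up to \<open>t\<close> itself.\<close>
lemma sobolev_W1_infinity_imp_lipschitz:
  fixes u :: "real \<Rightarrow> real"
  assumes ab: "a < b" and cont: "continuous_on {a..b} u" and sob: "sobolev_W1_infinity a b u"
  obtains C where "0 \<le> C" "\<And>x y. a < x \<Longrightarrow> x \<le> y \<Longrightarrow> y \<le> b \<Longrightarrow> \<bar>u y - u x\<bar> \<le> C * (y - x)"
proof -
  obtain g C where g: "weak_derivative a b u g" and "AE s in lebesgue. s \<in> {a<..<b} \<longrightarrow> \<bar>g s\<bar> \<le> C"
    using sob by (auto simp: sobolev_W1_infinity_def L_infinity_def)
  then have bound: "AE s in lebesgue. s \<in> {a<..<b} \<longrightarrow> \<bar>g s\<bar> \<le> max C 0"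
    by (elim AE_mp) (auto intro!: AE_I2)
  have contI: "continuous_on {a<..<b} u" using cont by (rule continuous_on_subset) auto
  have inner: "\<bar>u y - u x\<bar> \<le> max C 0 * (y - x)" if "a < x" "x \<le> y" "y < b" for x y
    by (rule weak_derivative_bounded_imp_lipschitz[OF contI g bound]) (use that in auto)
  have "\<bar>u y - u x\<bar> \<le> max C 0 * (y - x)" if x: "a < x" and "x \<le> y" "y \<le> b" for x y
  proof (cases "y < b \<or> x = y")
    case False
    then have y: "y = b" "x < b" using that by auto
    have cl: "closure {x<..<b} = {x..b}" using y by simp
    have "\<bar>u b - u x\<bar> - max C 0 * (b - x) \<le> 0"
    proof (rule continuous_le_on_closure[where S = "{x<..<b}"
          and f = "\<lambda>z. \<bar>u z - u x\<bar> - max C 0 * (z - x)" and x = b])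
      show "continuous_on (closure {x<..<b}) (\<lambda>z. \<bar>u z - u x\<bar> - max C 0 * (z - x))"
        unfolding cl using x by (intro continuous_intros continuous_on_subset[OF cont]) auto
    qed (use y x inner[of x] in \<open>auto simp: cl\<close>)
    then show ?thesis using y by simp
  qed (use that inner in auto)
  then show ?thesis using that[of "max C 0"] by auto
qed

section \<open>The lower bound\<close>

text \<open>The minimum principle for \<open>w - w 0 * e\<close> with \<open>e = relaxation_solution (\<alpha> j) c\<close>, \<open>c = lam / m\<close>. In
  the multiterm derivative of \<open>e\<close> the terms \<open>i \<noteq> j\<close> are nonpositive since \<open>e\<close> is nonincreasing, and
  the \<open>j\<close>-th is \<open>- q j s * c * e s \<le> - lam * e s\<close> since \<open>q j s * c \<ge> m * c = lam\<close>.\<close>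
lemma relaxation_solution_lower_bound:
  fixes w :: "real \<Rightarrow> real"
  assumes T: "T > 0" and \<alpha>: "\<And>i. i \<in> {1..l} \<Longrightarrow> 0 < \<alpha> i \<and> \<alpha> i \<le> 1"
    and q: "\<And>i t. i \<in> {1..l} \<Longrightarrow> t \<in> {0..T} \<Longrightarrow> 0 \<le> q i t"
    and qpos: "\<And>t. t \<in> {0..T} \<Longrightarrow> 0 < (\<Sum>i=1..l. q i t)"
    and lam: "0 \<le> lam"
    and cont: "continuous_on {0..T} w" and w0: "0 \<le> w 0"
    and ex: "\<And>i t. i \<in> {1..l} \<Longrightarrow> t \<in> {0<..T} \<Longrightarrow> caputo_exists T (\<alpha> i) w t"
    and super: "\<And>t. t \<in> {0<..T} \<Longrightarrow> 0 \<le> multiterm_deriv T l \<alpha> q w t + lam * w t"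
    and j: "j \<in> {1..l}" and m: "0 < m" and mq: "\<And>t. t \<in> {0..T} \<Longrightarrow> m \<le> q j t"
    and t: "t \<in> {0..T}"
  shows "w 0 * relaxation_solution (\<alpha> j) (lam / m) t \<le> w t"
proof -
  define c where "c = lam / m"
  define e where "e = relaxation_solution (\<alpha> j) c"
  have c: "0 \<le> c" using lam m by (simp add: c_def)
  have aj: "0 < \<alpha> j" "\<alpha> j \<le> 1" using \<alpha>[OF j] by auto
  have conte: "continuous_on {0..s} e" for s
    unfolding e_def using aj by (intro continuous_relaxation_solution) auto
  have exe: "caputo_exists T (\<alpha> i) e s" if "i \<in> {1..l}" "s \<in> {0<..T}" for i s
    using \<alpha>[OF that(1)] that conte has_field_derivative_relaxation_solution[OF aj(1), of s c]
    unfolding e_def by (intro caputo_exists_differentiable) auto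
  have e_nonneg: "0 \<le> e s" if "0 \<le> s" for s
    unfolding e_def relaxation_solution_def using aj c that by (intro mittag_leffler_nonneg) auto
  have sub: "multiterm_deriv T l \<alpha> q e s + lam * e s \<le> 0" if s: "s \<in> {0<..T}" for s
  proof -
    have s': "s \<in> {0..T}" using s by auto
    have "(\<Sum>i\<in>{1..l} - {j}. q i s * caputo_deriv T (\<alpha> i) e s) \<le> 0"
    proof (rule sum_nonpos)
      fix i assume i: "i \<in> {1..l} - {j}"
      have "caputo_deriv T (\<alpha> i) e s \<le> 0"
        using \<alpha>[of i] i s exe[of i s] relaxation_solution_antimono[OF aj c]
        by (intro caputo_deriv_nonpos) (auto simp: e_def)
      then show "q i s * caputo_deriv T (\<alpha> i) e s \<le> 0"
        using q[of i s] i s' by (intro mult_nonneg_nonpos) auto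
    qed
    then have "multiterm_deriv T l \<alpha> q e s \<le> q j s * caputo_deriv T (\<alpha> j) e s"
      unfolding multiterm_deriv_def
      using sum.remove[OF finite_atLeastAtMost j, of "\<lambda>i. q i s * caputo_deriv T (\<alpha> i) e s"] by linarith
    also have "\<dots> = - (q j s * c * e s)"
      using caputo_deriv_relaxation_solution[OF aj s, of c] by (simp add: e_def)
    also have "\<dots> \<le> - (lam * e s)"
    proof -
      have "lam = m * c" using m by (simp add: c_def)
      then have "lam \<le> q j s * c" using mq[OF s'] c by (simp add: mult_right_mono)
      then show ?thesis using e_nonneg[of s] s by (simp add: mult_right_mono)
    qed
    finally show ?thesis by simp
  qed
  define u where "u s = w s + (- w 0) * e s" for s
  have "0 \<le> u t"
  proof (rule multiterm_nonneg[OF T \<alpha> q qpos lam _ _ _ _ t])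
    show "continuous_on {0..T} u"
      unfolding u_def using cont conte by (intro continuous_intros)
    show "0 \<le> u 0" by (simp add: u_def e_def relaxation_solution_0)
    show "caputo_exists T (\<alpha> i) u s" if "i \<in> {1..l}" "s \<in> {0<..T}" for i s
      unfolding u_def using that by (intro caputo_linear ex exe)
    fix s assume s: "s \<in> {0<..T}"
    have "multiterm_deriv T l \<alpha> q u s
        = (\<Sum>i=1..l. q i s * (caputo_deriv T (\<alpha> i) w s + (- w 0) * caputo_deriv T (\<alpha> i) e s))"
      unfolding multiterm_deriv_def u_def
      by (intro sum.cong refl arg_cong2[where f = "(*)"] caputo_linear(2) ex exe s)
    also have "\<dots> = multiterm_deriv T l \<alpha> q w s + (- w 0) * multiterm_deriv T l \<alpha> q e s"
      unfolding multiterm_deriv_def sum_distrib_left sum.distrib[symmetric]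
      by (intro sum.cong refl) (simp add: algebra_simps)
    finally have "multiterm_deriv T l \<alpha> q u s + lam * u s = (multiterm_deriv T l \<alpha> q w s + lam * w s)
        - w 0 * (multiterm_deriv T l \<alpha> q e s + lam * e s)"
      by (simp add: u_def algebra_simps)
    moreover have "w 0 * (multiterm_deriv T l \<alpha> q e s + lam * e s) \<le> 0"
      using w0 sub[OF s] by (rule mult_nonneg_nonpos)
    ultimately show "0 \<le> multiterm_deriv T l \<alpha> q u s + lam * u s"
      using super[OF s] by linarith
  qed
  then show ?thesis by (simp add: u_def e_def c_def)
qed

lemma caputo_exists_if_sobolev:
  fixes w :: "real \<Rightarrow> real"
  assumes a: "0 < a" "a < 1" and t: "t \<in> {0<..T}"
    and cont: "continuous_on {0..T} w" and sob: "sobolev_W1_infinity (t / 2) t w"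
  shows "caputo_exists T a w t"
proof -
  have "continuous_on {t / 2..t} w" using cont by (rule continuous_on_subset) (use t in auto)
  then obtain C where C: "0 \<le> C"
    "\<And>x y. t / 2 < x \<Longrightarrow> x \<le> y \<Longrightarrow> y \<le> t \<Longrightarrow> \<bar>w y - w x\<bar> \<le> C * (y - x)"
    using sobolev_W1_infinity_imp_lipschitz[OF _ _ sob] t by auto
  show ?thesis
  proof (rule caputo_exists_lipschitz[OF a])
    show "continuous_on {0..t} w" using cont by (rule continuous_on_subset) (use t in auto)
    show "\<bar>w t - w s\<bar> \<le> C * (t - s)" if "s \<in> {0<..<t}" "t - s < t / 2" for s
      using that by (intro C) auto
  qed (use t C in auto)
qed

theorem theorem2p5:
  fixes T lam w0 :: real and l :: nat
    and \<alpha> :: "nat \<Rightarrow> real" and q :: "nat \<Rightarrow> real \<Rightarrow> real"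
    and v w :: "real \<Rightarrow> real"
  assumes "T > 0" and "l \<ge> 1"
    and "strict_antimono_on {1..l} \<alpha>" and "0 < \<alpha> l" and "\<alpha> 1 \<le> 1"
    and "\<forall>i\<in>{1..l}. continuous_on {0..T} (q i)"
    and "\<forall>i\<in>{1..l}. \<forall>t\<in>{0..T}. q i t \<ge> 0"
    and "\<forall>t\<in>{0..T}. (\<Sum>i=1..l. q i t) > 0"
    and "lam \<ge> 0"
    and "continuous_on {0..T} v" and "\<forall>t\<in>{0..T}. v t \<ge> 0"
    and "w0 \<ge> 0"
    and "\<forall>t\<in>{0<..T}. multiterm_deriv T l \<alpha> q w t + lam * w t = v t"
    and "w 0 = w0"
    and "continuous_on {0..T} w"
    and "\<forall>\<epsilon> t. 0 < \<epsilon> \<and> \<epsilon> < t \<and> t \<le> T \<longrightarrow> sobolev_W1_infinity \<epsilon> t w"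
    and "\<alpha> 1 = 1 \<longrightarrow> C1_half_open T w"
  shows "\<forall>t\<in>{0..T}. w t \<ge> w0 * Max ((\<lambda>j. ml_bound lam (\<alpha> j) (min_on T (q j)) t) ` {1..l})"
proof
  fix t assume t: "t \<in> {0..T}"
  have anti: "\<alpha> k < \<alpha> i" if "i \<in> {1..l}" "k \<in> {1..l}" "i < k" for i k
    using assms(3) that by (auto simp: monotone_on_def)
  have \<alpha>: "0 < \<alpha> i \<and> \<alpha> i \<le> 1" if "i \<in> {1..l}" for i
    using anti[of i l] anti[of 1 i] that assms(2,4,5) by (cases "i = l"; cases "i = 1") force+
  have \<alpha>1: "i = 1" if "i \<in> {1..l}" "\<alpha> i = 1" for i
    using anti[of 1 i] that assms(2,5) by (cases "i = 1") force+
  have q: "0 \<le> q i s" if "i \<in> {1..l}" "s \<in> {0..T}" for i s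
    using assms(7) that by blast
  have qpos: "0 < (\<Sum>i=1..l. q i s)" if "s \<in> {0..T}" for s
    using assms(8) that by blast
  have super: "0 \<le> multiterm_deriv T l \<alpha> q w s + lam * w s" if "s \<in> {0<..T}" for s
    using assms(11,13) that by auto
  have w0: "0 \<le> w 0" using assms(12,14) by simp
  have ex: "caputo_exists T (\<alpha> i) w s" if i: "i \<in> {1..l}" and s: "s \<in> {0<..T}" for i s
  proof (cases "\<alpha> i = 1")
    case True
    then have "C1_half_open T w" using \<alpha>1[OF i] assms(17) by auto
    then show ?thesis
      using True s unfolding C1_half_open_def caputo_exists_def
      by (auto intro: differentiableI_vector)
  next
    case False
    then show ?thesis
      using \<alpha>[OF i] s assms(15,16) by (intro caputo_exists_if_sobolev) auto
  qed
  have bound: "w0 * ml_bound lam (\<alpha> j) (min_on T (q j)) t \<le> w t" if j: "j \<in> {1..l}" for j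
  proof (cases "min_on T (q j) = 0")
    case True
    have "0 \<le> w t"
      by (rule multiterm_nonneg[OF assms(1) \<alpha> q qpos assms(9) assms(15) w0 ex super t])
    then show ?thesis by (simp add: ml_bound_def True)
  next
    case False
    have "0 \<le> min_on T (q j)"
      unfolding min_on_def using q[OF j] assms(1) by (intro cINF_greatest) auto
    then have m: "0 < min_on T (q j)" using False by simp
    have le: "min_on T (q j) \<le> q j s" if "s \<in> {0..T}" for s
      unfolding min_on_def using that q[OF j] by (intro cINF_lower bdd_belowI2[where m = 0]) auto
    show ?thesis
      using relaxation_solution_lower_bound[OF assms(1) \<alpha> q qpos assms(9) assms(15) w0 ex super j m le t] False
      by (simp add: ml_bound_def relaxation_solution_def assms(14))
  qed
  define B where "B = (\<lambda>j. ml_bound lam (\<alpha> j) (min_on T (q j)) t) ` {1..l}"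
  have "Max B \<in> B" unfolding B_def using assms(2) by (intro Max_in) auto
  then show "w t \<ge> w0 * Max ((\<lambda>j. ml_bound lam (\<alpha> j) (min_on T (q j)) t) ` {1..l})"
    using bound unfolding B_def by auto
qed

end
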